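(* If the number of time steps $T$ is fixed, then for every $\epsilon>0$ and for any sequence $\{r_n\}_{n\ge 1}$ increasing to infinity such that $r_n=o(n^{1/4})$, the maximum likelihood estimator $\hat\pi^{1:T}$ satisfies $$\mathbb{P}_{\theta^*}\left(\min_{\sigma\in\mathfrak{S}_Q}\|\pi^{*1:T}-\hat\pi^{1:T}_\sigma\|_\infty>\frac{\epsilon\, r_n}{n^{1/4}}\right)\xrightarrow[n\to\infty]{}0 ,$$ where $\hat\pi^{1:T}_\sigma=(\hat\pi^t_\sigma)_{t\in[T]}$.
   Context: Notation: $[M]=\{1,\dots,M\}$. Fix $T\ge 1$, the number of classes $Q\ge 2$ and constants $0<\delta<1/Q$, $0<\zeta<1/2$. Model (fixed $T$, time-varying connectivity). There are $n$ nodes observed at times $t=1,\dots,T$. The latent labels $Z_i=(Z_i^1,\dots,Z_i^T)$, $i\in[n]$, are i.i.d. homogeneous stationary Markov chains on $[Q]$ with transition matrix $\Gamma=(\gamma_{ql})_{q,l\in[Q]}$, started from its stationary distribution $\alpha$. Write $Z^t=(Z_1^t,\dots,Z_n^t)$, $Z^{1:T}=(Z^1,\dots,Z^T)$. The observations $X^{1:T}=(X^1,\dots,X^T)$ are symmetric binary adjacency matrices $X^t=(X^t_{ij})_{i,j\in[n]}$ with $X^t_{ii}=0$; conditionally on $Z^{1:T}$, the $X^t_{ij}$ ($i<j$, $t\in[T]$) are independent and $X^t_{ij}$ is Bernoulli with parameter $\pi^t_{Z^t_iZ^t_j}$, where $\pi^{1:T}=(\pi^1,\dots,\pi^T)$ and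 each $\pi^t=(\pi^t_{ql})$ is a symmetric $Q\times Q$ matrix. The parameter is $\theta=(\Gamma,\pi^{1:T})$ and $\mathbb{P}_\theta$ is the law of all variables under $\theta$. $\Theta^T$ is the set of $\theta=(\Gamma,\pi^{1:T})$ (with $\Gamma$ stochastic, $\pi^t$ symmetric) such that: for every $t$ and all $q\ne q'$ there is $l$ with $\pi^t_{ql}\ne\pi^t_{q'l}$; $\gamma_{ql}\in[\delta,1-\delta]$ for all $q,l$; $\pi^t_{ql}\in[\zeta,1-\zeta]$ for all $t,q,l$; and for every $q$ the value $\pi^t_{qq}=:\pi_{qq}$ does not depend on $t$, with $\{\pi_{qq}:q\in[Q]\}$ being $Q$ distinct values. The true parameter is $\theta^*=(\Gamma^*,\pi^{*1:T})\in\Theta^T$. The maximum likelihood estimator is $\hat\theta=(\hat\Gamma,\hat\pi^{1:T})=\operatorname{argmax}_{\theta\in\Theta^T}\log\mathbb{P}_\theta(X^{1:T})$. $\mathfrak{S}_Q$ is the set of permutations of $[Q]$, $\pi^t_\sigma=(\pi^t_{\sigma(q)\sigma(l)})_{q,l}$, and $\|\pi^{1:T}-\pi'^{1:T}\|_\infty=\max_{q,l,t}|\pi^t_{ql}-\pi'^t_{ql}|$. A sequence increasing to infinity is a positive sequence tending to $+\infty$. *)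

theory Defs
  imports
    "HOL-Probability.Probability"
    "HOL-Library.Landau_Symbols"
begin

text \<open>
  Labels live in a finite type \<open>'q\<close> with \<open>CARD('q)\<close> elements, nodes are the numbers \<open>{1..n}\<close> and
  times the numbers \<open>{1..T}\<close>. A parameter is a pair of a transition matrix and a family of
  connectivity matrices, of which only the entries at times in \<open>{1..T}\<close> are ever used.
\<close>

type_synonym 'q param = "(real^'q^'q) \<times> (nat \<Rightarrow> real^'q^'q)"

type_synonym 'q labels = "nat \<Rightarrow> nat \<Rightarrow> 'q"  \<comment> \<open>node, time\<close>

type_synonym graphs = "nat \<Rightarrow> nat \<Rightarrow> nat \<Rightarrow> bool"  \<comment> \<open>time, node, node\<close>

definition prob_vector :: "real^('q::finite) \<Rightarrow> bool" where
  "prob_vector v \<longleftrightarrow> (\<forall>q. 0 \<le> v $ q) \<and> (\<Sum>q\<in>UNIV. v $ q) = 1"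

definition stochastic :: "real^('q::finite)^'q \<Rightarrow> bool" where
  "stochastic \<Gamma> \<longleftrightarrow> (\<forall>q. prob_vector (\<Gamma> $ q))"

text \<open>Well defined when \<open>\<Gamma>\<close> is stochastic with positive entries, hence on the whole parameter set.\<close>

definition stationary :: "real^('q::finite)^'q \<Rightarrow> real^'q" where
  "stationary \<Gamma> = (THE \<alpha>. prob_vector \<alpha> \<and> \<alpha> v* \<Gamma> = \<alpha>)"

definition vec_pmf :: "real^('q::finite) \<Rightarrow> 'q pmf" where
  "vec_pmf v = embed_pmf (\<lambda>q. v $ q)"

text \<open>The law of \<open>(z 1, \<dots>, z T)\<close> for a Markov chain \<open>z\<close> with initial law \<open>\<mu>\<close> and kernel \<open>K\<close>.\<close>

primrec markov_path :: "'q pmf \<Rightarrow> ('q \<Rightarrow> 'q pmf) \<Rightarrow> nat \<Rightarrow> (nat \<Rightarrow> 'q) pmf" where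
  "markov_path \<mu> K 0 = return_pmf (\<lambda>_. undefined)"
| "markov_path \<mu> K (Suc t) =
     do {
       z \<leftarrow> markov_path \<mu> K t;
       q \<leftarrow> (if t = 0 then \<mu> else K (z t));
       return_pmf (z(Suc t := q))
     }"

definition label_law :: "nat \<Rightarrow> nat \<Rightarrow> real^('q::finite)^'q \<Rightarrow> 'q labels pmf" where
  "label_law n T \<Gamma> =
     Pi_pmf {1..n} (\<lambda>_. undefined)
       (\<lambda>_. markov_path (vec_pmf (stationary \<Gamma>)) (\<lambda>q. vec_pmf (\<Gamma> $ q)) T)"

definition edge_slots :: "nat \<Rightarrow> nat \<Rightarrow> (nat \<times> nat \<times> nat) set" where
  "edge_slots n T = {(t, i, j). t \<in> {1..T} \<and> i \<in> {1..n} \<and> j \<in> {1..n} \<and> i < j}"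

definition symmetrize :: "(nat \<times> nat \<times> nat \<Rightarrow> bool) \<Rightarrow> graphs" where
  "symmetrize y = (\<lambda>t i j. i \<noteq> j \<and> y (t, min i j, max i j))"

definition graph_law :: "nat \<Rightarrow> nat \<Rightarrow> (nat \<Rightarrow> real^('q::finite)^'q) \<Rightarrow> 'q labels \<Rightarrow> graphs pmf" where
  "graph_law n T \<pi> z =
     map_pmf symmetrize
       (Pi_pmf (edge_slots n T) False (\<lambda>(t, i, j). bernoulli_pmf (\<pi> t $ z i t $ z j t)))"

definition model_law :: "nat \<Rightarrow> nat \<Rightarrow> ('q::finite) param \<Rightarrow> ('q labels \<times> graphs) pmf" where
  "model_law n T \<theta> =
     do {
       z \<leftarrow> label_law n T (fst \<theta>);
       x \<leftarrow> graph_law n T (snd \<theta>) z;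
       return_pmf (z, x)
     }"

definition log_likelihood :: "nat \<Rightarrow> nat \<Rightarrow> ('q::finite) param \<Rightarrow> graphs \<Rightarrow> real" where
  "log_likelihood n T \<theta> x = ln (pmf (map_pmf snd (model_law n T \<theta>)) x)"

definition param_set :: "nat \<Rightarrow> real \<Rightarrow> real \<Rightarrow> ('q::finite) param set" where
  "param_set T \<delta> \<zeta> =
     {(\<Gamma>, \<pi>).
        stochastic \<Gamma> \<and>
        (\<forall>t\<in>{1..T}. transpose (\<pi> t) = \<pi> t) \<and>
        (\<forall>t\<in>{1..T}. \<forall>q q'. q \<noteq> q' \<longrightarrow> (\<exists>l. \<pi> t $ q $ l \<noteq> \<pi> t $ q' $ l)) \<and>
        (\<forall>q l. \<Gamma> $ q $ l \<in> {\<delta>..1 - \<delta>}) \<and>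
        (\<forall>t\<in>{1..T}. \<forall>q l. \<pi> t $ q $ l \<in> {\<zeta>..1 - \<zeta>}) \<and>
        (\<forall>t\<in>{1..T}. \<forall>t'\<in>{1..T}. \<forall>q. \<pi> t $ q $ q = \<pi> t' $ q $ q) \<and>
        (\<forall>t\<in>{1..T}. inj (\<lambda>q. \<pi> t $ q $ q))}"

text \<open>
  The parameter set is not closed, so for some graphs the likelihood has no maximizer on it (for
  all-empty graphs, for instance). An estimator is only constrained on the graphs for which a
  maximizer exists; requiring one for every graph would be unsatisfiable.
\<close>

definition is_mle :: "nat \<Rightarrow> nat \<Rightarrow> real \<Rightarrow> real \<Rightarrow> (graphs \<Rightarrow> ('q::finite) param) \<Rightarrow> bool" where
  "is_mle n T \<delta> \<zeta> est \<longleftrightarrow>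
     (\<forall>x. (\<exists>\<theta> :: 'q param. is_arg_max (\<lambda>\<theta>. log_likelihood n T \<theta> x) (\<lambda>\<theta>. \<theta> \<in> param_set T \<delta> \<zeta>) \<theta>) \<longrightarrow>
        is_arg_max (\<lambda>\<theta>. log_likelihood n T \<theta> x) (\<lambda>\<theta>. \<theta> \<in> param_set T \<delta> \<zeta>) (est x))"

definition permute_conn :: "(('q::finite) \<Rightarrow> 'q) \<Rightarrow> (nat \<Rightarrow> real^'q^'q) \<Rightarrow> (nat \<Rightarrow> real^'q^'q)" where
  "permute_conn \<sigma> \<pi> = (\<lambda>t. \<chi> q l. \<pi> t $ \<sigma> q $ \<sigma> l)"

definition conn_dist :: "nat \<Rightarrow> (nat \<Rightarrow> real^('q::finite)^'q) \<Rightarrow> (nat \<Rightarrow> real^'q^'q) \<Rightarrow> real" where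
  "conn_dist T \<pi> \<pi>' =
     (MAX (t, q, l) \<in> {1..T} \<times> UNIV \<times> UNIV. \<bar>\<pi> t $ q $ l - \<pi>' t $ q $ l\<bar>)"

end

theory Submission
  imports Defs "HOL-Real_Asymp.Real_Asymp"
begin

text \<open>
Write \<open>\<theta>\<^sup>*\<close> for the true parameter and \<open>z\<close> for the true labels. The likelihood is a mixture, over label
arrays \<open>z'\<close>, of products of Bernoulli probabilities, one for each time and each pair of nodes. So it is
at most the largest of these products, and for \<open>\<theta>\<^sup>*\<close> it is at least \<open>\<delta> ^ (n * T)\<close> times the product
at \<open>z\<close>, because each label has probability at least \<open>\<delta>\<close> given the past. Hence a parameter \<open>\<theta>\<close> whose
likelihood is at least that of \<open>\<theta>\<^sup>*\<close> has, for some \<open>z'\<close>, a product that is smaller than the true one by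
a factor \<open>exp (O(n))\<close> at most.

For fixed \<open>\<theta>\<close> and \<open>z'\<close>, let \<open>S\<close> be the sum, over times and pairs of nodes, of the squared differences
between the edge probabilities of \<open>(\<theta>, z')\<close> and those of \<open>(\<theta>\<^sup>*, z)\<close>. The expected square root of the
likelihood ratio is a product of Bernoulli affinities, so at most \<open>exp (- S / 4)\<close>, and Markov's inequality
gives an exponential tail (\<open>bernoulli_lik_ratio_tail\<close>). There are \<open>exp (O(n))\<close> label arrays, and
\<open>exp (O(n))\<close> connectivity matrices on a grid of mesh \<open>1 / n\<close>; rounding to the grid changes exponents by
\<open>O(n)\<close>. A union bound therefore shows that, outside an event of probability \<open>exp (- n)\<close>, every such \<open>\<theta>\<close>
has \<open>S = O(n)\<close> for some \<open>z'\<close> (\<open>competitive_params_have_small_discrepancy\<close>).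

With high probability each class has at least \<open>\<delta> * n / 4\<close> nodes at each time. Sending a class to the most
frequent value of \<open>z'\<close> on it gives a map \<open>\<sigma>\<close> of labels, and each entry \<open>(q, l)\<close> is tested by order
\<open>n ^ 2\<close> pairs of nodes. So \<open>S = O(n)\<close> forces the entries of the connectivity matrix of \<open>\<theta>\<close>, relabelled by
\<open>\<sigma>\<close>, to be within \<open>O(n ^ (- 1 / 2))\<close> of the true ones (\<open>matching_at_each_time\<close>). As the diagonal
entries of \<open>\<theta>\<^sup>*\<close> are distinct and do not change with time, \<open>\<sigma>\<close> is a permutation, the same one at all
times (\<open>relabelings_agree\<close>). Finally, constant multiples of \<open>n ^ (- 1 / 2)\<close> are eventually below \<open>\<epsilon> * r n * n ^ (- 1 / 4)\<close>.

The parameter set is not closed, so the existence of a maximizer needs an argument: the likelihood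
attains its maximum on a compact set containing all parameters (\<open>likelihood_maximizer_exists\<close>), and on the
good event the maximizer is close to \<open>\<theta>\<^sup>*\<close>, so that its diagonal entries are distinct too and it is a
genuine parameter.
\<close>

section \<open>Tails of Bernoulli likelihood ratios\<close>

text \<open>
With \<open>a, b\<close> the square roots of the success probabilities and \<open>c, d\<close> those of the failure probabilities,
the left-hand side is \<open>a * b + c * d = 1 - ((a - b)\<^sup>2 + (c - d)\<^sup>2) / 2\<close>, that is, one minus the squared
Hellinger distance. Each of the two squares is at least \<open>(p - q)\<^sup>2 / 4\<close>, since \<open>a + b\<close> and \<open>c + d\<close> are at most 2.
\<close>

lemma bernoulli_affinity:
  fixes p q :: real
  assumes "0 < p" "p < 1" "0 < q" "q < 1"
  shows "measure_pmf.expectation (bernoulli_pmf q)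
           (\<lambda>b. sqrt (pmf (bernoulli_pmf p) b / pmf (bernoulli_pmf q) b)) \<le> exp (- ((p - q)\<^sup>2 / 4))"
proof -
  define a b c d where "a = sqrt p" and "b = sqrt q" and "c = sqrt (1 - p)" and "d = sqrt (1 - q)"
  have pos: "0 < a" "0 < b" "0 < c" "0 < d"
    and sq: "a\<^sup>2 = p" "b\<^sup>2 = q" "c\<^sup>2 = 1 - p" "d\<^sup>2 = 1 - q"
    and le1: "a \<le> 1" "b \<le> 1" "c \<le> 1" "d \<le> 1"
    using assms by (auto simp: a_def b_def c_def d_def)
  have "measure_pmf.expectation (bernoulli_pmf q)
           (\<lambda>b. sqrt (pmf (bernoulli_pmf p) b / pmf (bernoulli_pmf q) b))
        = a / b * b\<^sup>2 + c / d * d\<^sup>2"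
    using assms by (simp add: real_sqrt_divide sq) (simp add: a_def b_def c_def d_def)
  also have "\<dots> = a * b + c * d"
    using pos by (simp add: power2_eq_square)
  also have "\<dots> = 1 - ((a - b)\<^sup>2 + (c - d)\<^sup>2) / 2"
    using sq by (simp add: power2_diff field_simps)
  also have "\<dots> \<le> 1 - (p - q)\<^sup>2 / 4"
  proof -
    have "(p - q)\<^sup>2 = (a - b)\<^sup>2 * (a + b)\<^sup>2"
      unfolding sq(1,2)[symmetric] by (simp add: power2_eq_square algebra_simps)
    also have "\<dots> \<le> (a - b)\<^sup>2 * 2\<^sup>2"
      using pos le1 by (intro mult_left_mono power_mono) auto
    finally have 1: "(p - q)\<^sup>2 \<le> 4 * (a - b)\<^sup>2" by simp
    have "(p - q)\<^sup>2 = ((1 - p) - (1 - q))\<^sup>2"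
      by (simp add: power2_commute)
    also have "\<dots> = (c - d)\<^sup>2 * (c + d)\<^sup>2"
      unfolding sq(3,4)[symmetric] by (simp add: power2_eq_square algebra_simps)
    also have "\<dots> \<le> (c - d)\<^sup>2 * 2\<^sup>2"
      using pos le1 by (intro mult_left_mono power_mono) auto
    finally have 2: "(p - q)\<^sup>2 \<le> 4 * (c - d)\<^sup>2" by simp
    show ?thesis using 1 2 by simp
  qed
  also have "\<dots> \<le> exp (- ((p - q)\<^sup>2 / 4))"
    using exp_ge_add_one_self[of "- ((p - q)\<^sup>2 / 4)"] by simp
  finally show ?thesis .
qed

definition bernoulli_lik :: "'i set \<Rightarrow> ('i \<Rightarrow> real) \<Rightarrow> ('i \<Rightarrow> bool) \<Rightarrow> real" where
  "bernoulli_lik I h y = (\<Prod>i\<in>I. pmf (bernoulli_pmf (h i)) (y i))"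

lemma pmf_bernoulli_pos: "0 < p \<Longrightarrow> p < 1 \<Longrightarrow> 0 < pmf (bernoulli_pmf p) b"
  by (cases b) auto

lemma bernoulli_lik_pos:
  assumes "\<And>i. i \<in> I \<Longrightarrow> 0 < h i \<and> h i < 1"
  shows "0 < bernoulli_lik I h y"
  unfolding bernoulli_lik_def using assms by (intro prod_pos) (auto intro: pmf_bernoulli_pos)

text \<open>
Markov's inequality for the square root of the likelihood ratio: by independence its mean is a product of
affinities, each of which contributes its squared difference to the exponent.
\<close>

lemma bernoulli_lik_ratio_tail:
  fixes g h :: "'i \<Rightarrow> real"
  assumes I: "finite I"
    and g: "\<And>i. i \<in> I \<Longrightarrow> 0 < g i \<and> g i < 1"
    and h: "\<And>i. i \<in> I \<Longrightarrow> 0 < h i \<and> h i < 1"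
  shows "measure_pmf.prob (Pi_pmf I False (\<lambda>i. bernoulli_pmf (g i)))
           {y. bernoulli_lik I g y * exp (2 * A - (\<Sum>i\<in>I. (h i - g i)\<^sup>2) / 2) \<le> bernoulli_lik I h y}
         \<le> exp (- A)"
proof -
  let ?M = "Pi_pmf I False (\<lambda>i. bernoulli_pmf (g i))"
  define S where "S = (\<Sum>i\<in>I. (h i - g i)\<^sup>2)"
  define f where "f = (\<lambda>i b. sqrt (pmf (bernoulli_pmf (h i)) b / pmf (bernoulli_pmf (g i)) b))"
  define W where "W = (\<lambda>y. \<Prod>i\<in>I. f i (y i))"
  have fin: "finite (set_pmf ?M)"
    using I by (auto simp: set_Pi_pmf)
  have int: "integrable ?M W"
    by (rule integrable_measure_pmf_finite[OF fin])
  have W0: "0 \<le> W y" for y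
    unfolding W_def f_def by (intro prod_nonneg) auto
  have W2: "(W y)\<^sup>2 = bernoulli_lik I h y / bernoulli_lik I g y" for y
    unfolding W_def f_def bernoulli_lik_def
    by (simp add: prod_power_distrib prod_dividef del: real_sqrt_divide)
  have "measure_pmf.expectation ?M W = (\<Prod>i\<in>I. measure_pmf.expectation (bernoulli_pmf (g i)) (f i))"
    unfolding W_def using I
    by (intro expectation_prod_Pi_pmf) (auto intro: integrable_measure_pmf_finite simp: f_def)
  also have "\<dots> \<le> (\<Prod>i\<in>I. exp (- ((h i - g i)\<^sup>2 / 4)))"
    unfolding f_def using g h
    by (intro prod_mono conjI bernoulli_affinity integral_nonneg) auto
  also have "\<dots> = exp (- S / 4)"
    using I by (simp add: exp_sum[symmetric] S_def sum_divide_distrib sum_negf)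
  finally have E: "measure_pmf.expectation ?M W \<le> exp (- S / 4)" .
  have "{y. bernoulli_lik I g y * exp (2 * A - S / 2) \<le> bernoulli_lik I h y} \<subseteq> {y \<in> space ?M. exp (A - S / 4) \<le> W y}"
  proof safe
    fix y assume "bernoulli_lik I g y * exp (2 * A - S / 2) \<le> bernoulli_lik I h y"
    then have "exp (2 * A - S / 2) \<le> (W y)\<^sup>2"
      using bernoulli_lik_pos[of I g y] g by (simp add: W2 pos_le_divide_eq mult.commute)
    also have "exp (2 * A - S / 2) = (exp (A - S / 4))\<^sup>2"
      by (simp add: exp_double[symmetric] right_diff_distrib)
    finally show "exp (A - S / 4) \<le> W y"
      using W0 by (rule power2_le_imp_le)
  qed auto
  then have "measure_pmf.prob ?M {y. bernoulli_lik I g y * exp (2 * A - S / 2) \<le> bernoulli_lik I h y}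
      \<le> measure_pmf.prob ?M {y \<in> space ?M. exp (A - S / 4) \<le> W y}"
    by (intro measure_pmf.finite_measure_mono) auto
  also have "\<dots> \<le> measure_pmf.expectation ?M W / exp (A - S / 4)"
    using int W0 by (intro integral_Markov_inequality_measure[where A = "{}"]) auto
  also have "\<dots> \<le> exp (- S / 4) / exp (A - S / 4)"
    using E by (simp add: divide_right_mono)
  also have "\<dots> = exp (- A)"
    by (simp add: exp_diff[symmetric])
  finally show ?thesis unfolding S_def .
qed

lemma bernoulli_lik_ratio_family_tail:
  fixes g :: "'i \<Rightarrow> real"
  assumes I: "finite I" and H: "finite H"
    and g: "\<And>i. i \<in> I \<Longrightarrow> 0 < g i \<and> g i < 1"
    and h: "\<And>h i. h \<in> H \<Longrightarrow> i \<in> I \<Longrightarrow> 0 < h i \<and> h i < 1"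
  shows "measure_pmf.prob (Pi_pmf I False (\<lambda>i. bernoulli_pmf (g i)))
           {y. \<exists>h\<in>H. bernoulli_lik I g y * exp (2 * A - (\<Sum>i\<in>I. (h i - g i)\<^sup>2) / 2) \<le> bernoulli_lik I h y}
         \<le> card H * exp (- A)"
proof -
  let ?M = "Pi_pmf I False (\<lambda>i. bernoulli_pmf (g i))"
  let ?B = "\<lambda>h. {y. bernoulli_lik I g y * exp (2 * A - (\<Sum>i\<in>I. (h i - g i)\<^sup>2) / 2) \<le> bernoulli_lik I h y}"
  have "measure_pmf.prob ?M (\<Union>h\<in>H. ?B h) \<le> (\<Sum>h\<in>H. measure_pmf.prob ?M (?B h))"
    using H by (intro measure_pmf.finite_measure_subadditive_finite) auto
  also have "\<dots> \<le> (\<Sum>h\<in>H. exp (- A))"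
    using I g h by (intro sum_mono bernoulli_lik_ratio_tail) auto
  finally have "measure_pmf.prob ?M (\<Union>h\<in>H. ?B h) \<le> card H * exp (- A)"
    by simp
  moreover have "(\<Union>h\<in>H. ?B h) = {y. \<exists>h\<in>H. bernoulli_lik I g y * exp (2 * A - (\<Sum>i\<in>I. (h i - g i)\<^sup>2) / 2) \<le> bernoulli_lik I h y}"
    by auto
  ultimately show ?thesis by simp
qed

text \<open>
The log-likelihood of one observation has slope at most \<open>1 / \<zeta>\<close> in the success probability, as long as the
latter stays away from 0 and 1. This is what lets a grid stand for all parameters.
\<close>

lemma bernoulli_lik_perturb:
  fixes h h' :: "'i \<Rightarrow> real"
  assumes I: "finite I" and "0 < \<zeta>"
    and h: "\<And>i. i \<in> I \<Longrightarrow> h i \<in> {\<zeta>..1 - \<zeta>}" and h': "\<And>i. i \<in> I \<Longrightarrow> h' i \<in> {\<zeta>..1 - \<zeta>}"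
    and close: "\<And>i. i \<in> I \<Longrightarrow> \<bar>h i - h' i\<bar> \<le> e"
  shows "bernoulli_lik I h y \<le> bernoulli_lik I h' y * exp (card I * (e / \<zeta>))"
proof -
  have "bernoulli_lik I h y \<le> (\<Prod>i\<in>I. pmf (bernoulli_pmf (h' i)) (y i) * exp (e / \<zeta>))"
    unfolding bernoulli_lik_def
  proof (intro prod_mono conjI pmf_nonneg)
    fix i assume i: "i \<in> I"
    let ?b = "\<lambda>p. pmf (bernoulli_pmf p) (y i)"
    have ge: "\<zeta> \<le> ?b (h' i)" and diff: "?b (h i) \<le> ?b (h' i) + e"
      using h[OF i] h'[OF i] close[OF i] \<open>0 < \<zeta>\<close> by (cases "y i"; auto)+
    have "0 \<le> e" using close[OF i] by linarith
    have "e = \<zeta> * (e / \<zeta>)" using \<open>0 < \<zeta>\<close> by simp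
    also have "\<dots> \<le> ?b (h' i) * (e / \<zeta>)"
      using ge \<open>0 \<le> e\<close> \<open>0 < \<zeta>\<close> by (intro mult_right_mono) auto
    finally have "?b (h i) \<le> ?b (h' i) * (1 + e / \<zeta>)"
      using diff by (simp add: algebra_simps)
    also have "\<dots> \<le> ?b (h' i) * exp (e / \<zeta>)"
      by (intro mult_left_mono exp_ge_add_one_self) auto
    finally show "?b (h i) \<le> ?b (h' i) * exp (e / \<zeta>)" .
  qed
  also have "\<dots> = bernoulli_lik I h' y * exp (card I * (e / \<zeta>))"
    by (simp add: prod.distrib bernoulli_lik_def exp_of_nat_mult del: times_divide_eq_right)
  finally show ?thesis .
qed

lemma sum_sq_diff_perturb:
  fixes g h h' :: "'i \<Rightarrow> real" and e :: real
  assumes I: "finite I"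
    and "\<And>i. i \<in> I \<Longrightarrow> g i \<in> {0..1}" "\<And>i. i \<in> I \<Longrightarrow> h i \<in> {0..1}" "\<And>i. i \<in> I \<Longrightarrow> h' i \<in> {0..1}"
    and close: "\<And>i. i \<in> I \<Longrightarrow> \<bar>h i - h' i\<bar> \<le> e"
  shows "(\<Sum>i\<in>I. (h i - g i)\<^sup>2) \<le> (\<Sum>i\<in>I. (h' i - g i)\<^sup>2) + card I * (2 * e)"
proof -
  have "(\<Sum>i\<in>I. (h i - g i)\<^sup>2) \<le> (\<Sum>i\<in>I. (h' i - g i)\<^sup>2 + 2 * e)"
  proof (intro sum_mono)
    fix i assume i: "i \<in> I"
    have "(h i - g i)\<^sup>2 - (h' i - g i)\<^sup>2 = (h i - h' i) * (h i + h' i - 2 * g i)"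
      by (simp add: power2_eq_square algebra_simps)
    also have "\<dots> \<le> \<bar>h i - h' i\<bar> * \<bar>h i + h' i - 2 * g i\<bar>"
      by (metis abs_ge_self abs_mult)
    also have "\<dots> \<le> e * 2"
      using assms(2-4)[OF i] close[OF i] by (intro mult_mono) auto
    finally show "(h i - g i)\<^sup>2 \<le> (h' i - g i)\<^sup>2 + 2 * e" by simp
  qed
  then show ?thesis by (simp add: sum.distrib)
qed

section \<open>Stationary laws and the law of the labels\<close>

lemma pmf_vec_pmf:
  assumes "prob_vector v"
  shows "pmf (vec_pmf v) q = v $ q"
proof -
  have "(\<Sum>q\<in>UNIV. ennreal (v $ q)) = ennreal (\<Sum>q\<in>UNIV. v $ q)"
    using assms by (intro sum_ennreal) (auto simp: prob_vector_def)
  then show ?thesis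
    using assms unfolding vec_pmf_def
    by (intro pmf_embed_pmf) (auto simp: prob_vector_def nn_integral_count_space_finite)
qed

text \<open>
Doeblin's contraction: the difference of two stationary laws has total mass 0, so subtracting the constant
\<open>\<delta>\<close> from all entries of \<open>\<Gamma>\<close> leaves its image unchanged. The remaining nonnegative matrix has row sums
\<open>1 - CARD('q) * \<delta> < 1\<close>, which shrinks the \<open>L\<^sup>1\<close> norm strictly unless it is 0.
\<close>

lemma stationary_unique:
  fixes \<Gamma> :: "real^('q::finite)^'q"
  assumes st: "stochastic \<Gamma>" and "0 < \<delta>" and ge: "\<And>q l. \<delta> \<le> \<Gamma> $ q $ l"
    and a: "prob_vector a" "a v* \<Gamma> = a" and b: "prob_vector b" "b v* \<Gamma> = b"
  shows "a = b"
proof -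
  define d where "d = (\<lambda>q. a $ q - b $ q)"
  have sum_d: "(\<Sum>q\<in>UNIV. d q) = 0"
    using a b by (simp add: d_def sum_subtractf prob_vector_def)
  have fix_a: "a $ l = (\<Sum>q\<in>UNIV. \<Gamma> $ q $ l * a $ q)" and fix_b: "b $ l = (\<Sum>q\<in>UNIV. \<Gamma> $ q $ l * b $ q)" for l
    using arg_cong[OF a(2), of "\<lambda>v. v $ l"] arg_cong[OF b(2), of "\<lambda>v. v $ l"]
    by (simp_all add: vector_matrix_mult_def mult.commute)
  have fix_d: "d l = (\<Sum>q\<in>UNIV. (\<Gamma> $ q $ l - \<delta>) * d q)" for l
  proof -
    have "d l = (\<Sum>q\<in>UNIV. \<Gamma> $ q $ l * d q)"
      unfolding d_def by (subst fix_a, subst fix_b) (simp add: right_diff_distrib sum_subtractf)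
    then show ?thesis
      using sum_d by (simp add: left_diff_distrib sum_subtractf sum_distrib_left[symmetric])
  qed
  have "(\<Sum>l\<in>UNIV. \<bar>d l\<bar>) \<le> (\<Sum>l\<in>UNIV. \<Sum>q\<in>UNIV. (\<Gamma> $ q $ l - \<delta>) * \<bar>d q\<bar>)"
  proof (intro sum_mono)
    fix l
    have "\<bar>d l\<bar> \<le> (\<Sum>q\<in>UNIV. \<bar>(\<Gamma> $ q $ l - \<delta>) * d q\<bar>)"
      by (subst fix_d) (rule sum_abs)
    then show "\<bar>d l\<bar> \<le> (\<Sum>q\<in>UNIV. (\<Gamma> $ q $ l - \<delta>) * \<bar>d q\<bar>)"
      using ge by (simp add: abs_mult)
  qed
  also have "\<dots> = (\<Sum>q\<in>UNIV. \<Sum>l\<in>UNIV. (\<Gamma> $ q $ l - \<delta>) * \<bar>d q\<bar>)"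
    by (rule sum.swap)
  also have "\<dots> = (\<Sum>q\<in>UNIV. (1 - CARD('q) * \<delta>) * \<bar>d q\<bar>)"
    using st by (simp add: sum_distrib_right[symmetric] sum_subtractf stochastic_def prob_vector_def)
  also have "\<dots> = (1 - CARD('q) * \<delta>) * (\<Sum>q\<in>UNIV. \<bar>d q\<bar>)"
    by (simp add: sum_distrib_left)
  finally have "CARD('q) * \<delta> * (\<Sum>q\<in>UNIV. \<bar>d q\<bar>) \<le> 0"
    by (simp add: algebra_simps)
  then have "(\<Sum>q\<in>UNIV. \<bar>d q\<bar>) \<le> 0"
    using \<open>0 < \<delta>\<close> by (simp add: mult_le_0_iff)
  then have "\<bar>d q\<bar> = 0" for q
    by (metis (no_types, lifting) UNIV_I abs_ge_zero finite order_antisym sum_nonneg sum_nonneg_eq_0_iff)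
  then show ?thesis
    by (simp add: d_def vec_eq_iff)
qed

text \<open>
Brouwer's theorem on the simplex of probability vectors.
\<close>

lemma stationary_exists:
  fixes \<Gamma> :: "real^('q::finite)^'q"
  assumes st: "stochastic \<Gamma>"
  shows "\<exists>a. prob_vector a \<and> a v* \<Gamma> = a"
proof -
  let ?S = "Collect prob_vector :: (real^'q) set"
  have cl: "closed ?S"
    unfolding prob_vector_def
    by (intro closed_Collect_conj closed_Collect_all closed_Collect_le closed_Collect_eq continuous_intros)
  have "?S \<subseteq> cbox 0 (\<chi> q. 1)"
  proof
    fix v :: "real^'q" assume "v \<in> ?S"
    then have v: "\<And>q. 0 \<le> v $ q" "(\<Sum>q\<in>UNIV. v $ q) = 1"
      by (auto simp: prob_vector_def)
    have "v $ q \<le> 1" for q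
      using v by (metis (no_types, lifting) UNIV_I finite member_le_sum)
    with v show "v \<in> cbox 0 (\<chi> q. 1)"
      by (auto simp: mem_box_cart)
  qed
  then have "bounded ?S"
    using bounded_cbox bounded_subset by blast
  with cl have cpt: "compact ?S"
    by (simp add: compact_eq_bounded_closed)
  have cvx: "convex ?S"
    by (auto simp: convex_def prob_vector_def sum.distrib sum_distrib_left[symmetric])
  have "prob_vector (\<chi> q::'q. 1 / CARD('q))"
    by (simp add: prob_vector_def)
  then have ne: "?S \<noteq> {}" by blast
  have cont: "continuous_on ?S (\<lambda>a. a v* \<Gamma>)"
    unfolding vector_matrix_mult_def by (intro continuous_intros)
  have maps: "(\<lambda>a. a v* \<Gamma>) \<in> ?S \<rightarrow> ?S"
  proof
    fix a assume "a \<in> ?S"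
    then have a: "\<And>q. 0 \<le> a $ q" "(\<Sum>q\<in>UNIV. a $ q) = 1"
      by (auto simp: prob_vector_def)
    have G: "\<And>q l. 0 \<le> \<Gamma> $ q $ l" "\<And>q. (\<Sum>l\<in>UNIV. \<Gamma> $ q $ l) = 1"
      using st by (auto simp: stochastic_def prob_vector_def)
    have "(\<Sum>l\<in>UNIV. \<Sum>q\<in>UNIV. \<Gamma> $ q $ l * a $ q) = (\<Sum>q\<in>UNIV. \<Sum>l\<in>UNIV. \<Gamma> $ q $ l * a $ q)"
      by (rule sum.swap)
    also have "\<dots> = 1"
      using a G by (simp add: sum_distrib_right[symmetric])
    finally show "a v* \<Gamma> \<in> ?S"
      using a G by (auto simp: prob_vector_def vector_matrix_mult_def mult.commute intro!: sum_nonneg)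
  qed
  from brouwer[OF cpt cvx ne cont maps] show ?thesis by auto
qed

lemma stationary_eqI:
  fixes \<Gamma> :: "real^('q::finite)^'q"
  assumes "stochastic \<Gamma>" "0 < \<delta>" "\<And>q l. \<delta> \<le> \<Gamma> $ q $ l"
    and "prob_vector a" "a v* \<Gamma> = a"
  shows "stationary \<Gamma> = a"
  unfolding stationary_def
  by (rule the_equality) (use assms stationary_unique[OF assms(1-3)] in auto)

lemma stationary_props:
  fixes \<Gamma> :: "real^('q::finite)^'q"
  assumes st: "stochastic \<Gamma>" and "0 < \<delta>" and ge: "\<And>q l. \<delta> \<le> \<Gamma> $ q $ l"
  shows "prob_vector (stationary \<Gamma>)" "stationary \<Gamma> v* \<Gamma> = stationary \<Gamma>" "\<delta> \<le> stationary \<Gamma> $ q"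
proof -
  obtain a where a: "prob_vector a" "a v* \<Gamma> = a"
    using stationary_exists[OF st] by blast
  have eq: "stationary \<Gamma> = a"
    by (rule stationary_eqI[OF assms a])
  show "prob_vector (stationary \<Gamma>)" "stationary \<Gamma> v* \<Gamma> = stationary \<Gamma>"
    using a by (simp_all add: eq)
  have "\<delta> = (\<Sum>l\<in>UNIV. \<delta> * a $ l)"
    using a by (simp add: sum_distrib_left[symmetric] prob_vector_def)
  also have "\<dots> \<le> (\<Sum>l\<in>UNIV. \<Gamma> $ l $ q * a $ l)"
    using a ge by (intro sum_mono mult_right_mono) (auto simp: prob_vector_def)
  also have "\<dots> = a $ q"
    using arg_cong[OF a(2), of "\<lambda>v. v $ q"] by (simp add: vector_matrix_mult_def mult.commute)
  finally show "\<delta> \<le> stationary \<Gamma> $ q" by (simp add: eq)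
qed

definition paths :: "nat \<Rightarrow> (nat \<Rightarrow> 'q) set" where
  "paths T = PiE_dflt {1..T} undefined (\<lambda>_. UNIV)"

text \<open>
The product formula gives both the lower bound on the probability of a label array and the continuity of the
likelihood in the transition matrix and its stationary law.
\<close>

lemma pmf_markov_path:
  "pmf (markov_path \<mu> K T) w =
     (if w \<in> paths T then \<Prod>t\<in>{1..T}. pmf (if t = 1 then \<mu> else K (w (t - 1))) (w t) else 0)"
proof (induction T arbitrary: w)
  case 0
  have "w \<in> paths 0 \<longleftrightarrow> w = (\<lambda>_. undefined)"
    by (auto simp: paths_def PiE_dflt_def)
  then show ?case by (simp add: indicator_def)
next
  case (Suc T)
  let ?w = "w(Suc T := undefined)"
  let ?K = "\<lambda>w. if T = 0 then \<mu> else K (w T)"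
  have supp: "w' (Suc T) = undefined" if "w' \<in> set_pmf (markov_path \<mu> K T)" for w'
  proof -
    have "w' \<in> paths T" using that by (metis Suc.IH set_pmf_iff)
    then show ?thesis by (simp add: paths_def PiE_dflt_def)
  qed
  define step where "step = (\<lambda>w'. pmf (map_pmf (\<lambda>q. w'(Suc T := q)) (?K w')) w)"
  have step: "step w' = (if w' = ?w then pmf (?K ?w) (w (Suc T)) else 0)"
    if w': "w' \<in> set_pmf (markov_path \<mu> K T)" for w'
  proof (cases "w' = ?w")
    case True
    have "pmf (map_pmf (\<lambda>q. w'(Suc T := q)) (?K w')) (w'(Suc T := w (Suc T))) = pmf (?K w') (w (Suc T))"
      by (rule pmf_map_inj') (auto simp: inj_def dest: fun_upd_eqD)
    also have "w'(Suc T := w (Suc T)) = w" using True by simp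
    finally show ?thesis unfolding step_def if_P[OF True] unfolding True[symmetric] .
  next
    case False
    have "w \<notin> range (\<lambda>q. w'(Suc T := q))"
    proof
      assume "w \<in> range (\<lambda>q. w'(Suc T := q))"
      then have "w' = ?w" using supp[OF w'] by (auto simp: fun_eq_iff)
      with False show False ..
    qed
    then have "step w' = 0"
      by (auto simp: pmf_eq_0_set_pmf step_def)
    with False show ?thesis by simp
  qed
  have "pmf (markov_path \<mu> K (Suc T)) w = measure_pmf.expectation (markov_path \<mu> K T) step"
    by (simp add: map_pmf_def pmf_bind step_def del: fun_upd_apply)
  also have "\<dots> = (\<Sum>w'\<in>{?w}. step w' * pmf (markov_path \<mu> K T) w')"
    using step by (intro integral_measure_pmf_real) (auto split: if_splits)
  also have "\<dots> = pmf (?K ?w) (w (Suc T)) * pmf (markov_path \<mu> K T) ?w"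
  proof (cases "?w \<in> set_pmf (markov_path \<mu> K T)")
    case True
    then show ?thesis using step[OF True] by simp
  next
    case False
    then show ?thesis by (simp add: pmf_eq_0_set_pmf)
  qed
  also have "\<dots> = (if w \<in> paths (Suc T) then \<Prod>t\<in>{1..Suc T}. pmf (if t = 1 then \<mu> else K (w (t - 1))) (w t) else 0)"
  proof -
    have mem: "?w \<in> paths T \<longleftrightarrow> w \<in> paths (Suc T)"
      by (auto simp: paths_def PiE_dflt_def)
    have "(\<Prod>t\<in>{1..T}. pmf (if t = 1 then \<mu> else K (?w (t - 1))) (?w t))
        = (\<Prod>t\<in>{1..T}. pmf (if t = 1 then \<mu> else K (w (t - 1))) (w t))"
      by (intro prod.cong refl) auto
    moreover have "{1..Suc T} = insert (Suc T) {1..T}" by auto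
    moreover have "?K ?w = (if Suc T = 1 then \<mu> else K (w (Suc T - 1)))" by simp
    ultimately show ?thesis
      unfolding Suc.IH mem by simp
  qed
  finally show ?case .
qed

definition labelings :: "nat \<Rightarrow> nat \<Rightarrow> 'q labels set" where
  "labelings n T = PiE_dflt {1..n} (\<lambda>_. undefined) (\<lambda>_. paths T)"

lemma finite_paths [simp]: "finite (paths T :: (nat \<Rightarrow> 'q::finite) set)"
  unfolding paths_def by auto

lemma finite_labelings [simp]: "finite (labelings n T :: 'q::finite labels set)"
  unfolding labelings_def by (intro finite_PiE_dflt) auto

lemma card_labelings: "card (labelings n T :: 'q::finite labels set) = CARD('q) ^ (n * T)"
proof -
  have "card (paths T :: (nat \<Rightarrow> 'q) set) = CARD('q) ^ T"
    unfolding paths_def by (subst card_PiE_dflt) auto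
  then show ?thesis
    unfolding labelings_def by (subst card_PiE_dflt) (auto simp: power_mult[symmetric] mult.commute)
qed

lemma set_markov_path: "set_pmf (markov_path \<mu> K T) \<subseteq> paths T"
  by (metis pmf_markov_path set_pmf_iff subsetI)

lemma set_label_law: "set_pmf (label_law n T \<Gamma>) \<subseteq> labelings n T"
  using set_markov_path
  by (fastforce simp: label_law_def labelings_def set_Pi_pmf PiE_dflt_def)

lemma pmf_label_law:
  assumes "z \<in> labelings n T"
  shows "pmf (label_law n T \<Gamma>) z =
    (\<Prod>i\<in>{1..n}. \<Prod>t\<in>{1..T}.
       pmf (if t = 1 then vec_pmf (stationary \<Gamma>) else vec_pmf (\<Gamma> $ z i (t - 1))) (z i t))"
proof -
  have "pmf (label_law n T \<Gamma>) z
      = (\<Prod>i\<in>{1..n}. pmf (markov_path (vec_pmf (stationary \<Gamma>)) (\<lambda>q. vec_pmf (\<Gamma> $ q)) T) (z i))"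
    using assms unfolding label_law_def labelings_def by (subst pmf_Pi) (auto simp: PiE_dflt_def)
  also have "\<dots> = (\<Prod>i\<in>{1..n}. \<Prod>t\<in>{1..T}.
       pmf (if t = 1 then vec_pmf (stationary \<Gamma>) else vec_pmf (\<Gamma> $ z i (t - 1))) (z i t))"
  proof (intro prod.cong refl)
    fix i assume "i \<in> {1..n}"
    then have "z i \<in> paths T" using assms by (auto simp: labelings_def PiE_dflt_def)
    then show "pmf (markov_path (vec_pmf (stationary \<Gamma>)) (\<lambda>q. vec_pmf (\<Gamma> $ q)) T) (z i)
       = (\<Prod>t\<in>{1..T}. pmf (if t = 1 then vec_pmf (stationary \<Gamma>) else vec_pmf (\<Gamma> $ z i (t - 1))) (z i t))"
      by (simp add: pmf_markov_path)
  qed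
  finally show ?thesis .
qed

lemma pmf_label_law_ge:
  fixes \<Gamma> :: "real^('q::finite)^'q"
  assumes st: "stochastic \<Gamma>" and "0 < \<delta>" and ge: "\<And>q l. \<delta> \<le> \<Gamma> $ q $ l"
    and z: "z \<in> labelings n T"
  shows "\<delta> ^ (n * T) \<le> pmf (label_law n T \<Gamma>) z"
proof -
  have "\<delta> ^ (n * T) = (\<Prod>i\<in>{1..n}. \<Prod>t\<in>{1..T}. \<delta>)"
    by (simp add: power_mult[symmetric] mult.commute)
  also have "\<dots> \<le> pmf (label_law n T \<Gamma>) z"
    unfolding pmf_label_law[OF z]
    using assms stationary_props[OF st \<open>0 < \<delta>\<close> ge]
    by (intro prod_mono conjI prod_nonneg) (auto simp: pmf_vec_pmf stochastic_def)
  finally show ?thesis .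
qed

section \<open>Class sizes\<close>

lemma prob_bind_pmf_le:
  assumes "\<And>z. z \<in> set_pmf M \<Longrightarrow> z \<notin> B \<Longrightarrow> measure_pmf.prob (f z) E \<le> c" and "0 \<le> c"
  shows "measure_pmf.prob (bind_pmf M f) E \<le> measure_pmf.prob M B + c"
proof -
  have "ennreal (measure_pmf.prob (bind_pmf M f) E) = (\<integral>\<^sup>+z. ennreal (measure_pmf.prob (f z) E) \<partial>M)"
    by (simp flip: measure_pmf.emeasure_eq_measure)
  also have "\<dots> \<le> (\<integral>\<^sup>+z. indicator B z + ennreal c \<partial>M)"
    using assms by (intro nn_integral_mono_AE)
      (auto simp: AE_measure_pmf_iff indicator_def intro: order_trans[OF _ add_increasing2])
  also have "\<dots> = ennreal (measure_pmf.prob M B + c)"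
    using \<open>0 \<le> c\<close> by (subst nn_integral_add)
      (auto simp: measure_pmf.emeasure_eq_measure measure_pmf.emeasure_space_1)
  finally show ?thesis
    using \<open>0 \<le> c\<close> by (subst (asm) ennreal_le_iff) auto
qed

text \<open>
Conditionally on the path before time \<open>t\<close>, the label at time \<open>t\<close> is \<open>q\<close> with probability at least \<open>\<delta>\<close>;
averaging over that path preserves the bound.
\<close>

lemma markov_path_marginal_ge:
  assumes "t \<in> {1..T}" and \<mu>: "\<delta> \<le> pmf \<mu> q" and K: "\<And>q'. \<delta> \<le> pmf (K q') q"
  shows "\<delta> \<le> measure_pmf.prob (markov_path \<mu> K T) {w. w t = q}"
  using assms(1)
proof (induction T)
  case (Suc T)
  let ?K = "\<lambda>w. if T = 0 then \<mu> else K (w T)"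
  have map: "map_pmf (\<lambda>w. w t) (markov_path \<mu> K (Suc T))
      = bind_pmf (markov_path \<mu> K T) (\<lambda>w. map_pmf (\<lambda>q. (w(Suc T := q)) t) (?K w))"
    by (simp add: map_pmf_def bind_assoc_pmf bind_return_pmf)
  have vim: "measure_pmf.prob M {w. w t = q} = pmf (map_pmf (\<lambda>w. w t) M) q" for M :: "(nat \<Rightarrow> 'a) pmf"
    by (simp add: pmf_map vimage_def)
  show ?case
  proof (cases "t = Suc T")
    case True
    have "\<delta> = measure_pmf.expectation (markov_path \<mu> K T) (\<lambda>_. \<delta>)" by simp
    also have "\<dots> \<le> measure_pmf.expectation (markov_path \<mu> K T) (\<lambda>w. pmf (?K w) q)"
    proof (rule integral_mono)
      show "integrable (markov_path \<mu> K T) (\<lambda>w. pmf (?K w) q)"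
        by (rule measure_pmf.integrable_const_bound[where B = 1]) (auto simp: pmf_le_1)
    qed (use \<mu> K in auto)
    also have "\<dots> = pmf (map_pmf (\<lambda>w. w t) (markov_path \<mu> K (Suc T))) q"
      unfolding map by (simp add: True pmf_bind)
    finally show ?thesis by (simp add: vim del: markov_path.simps)
  next
    case False
    then have "map_pmf (\<lambda>w. w t) (markov_path \<mu> K (Suc T)) = map_pmf (\<lambda>w. w t) (markov_path \<mu> K T)"
      unfolding map by (simp add: map_pmf_def)
    then show ?thesis
      using Suc False by (simp add: vim del: markov_path.simps)
  qed
qed simp

text \<open>
Chernoff's bound for the weight \<open>(1 / 2) ^ count\<close>: its mean is at most \<open>exp (- \<delta> * card I / 2)\<close>, while a
count below \<open>\<delta> * card I / 4\<close> makes it larger than \<open>exp (- \<delta> * card I / 4)\<close>, as \<open>1 / 2 \<ge> exp (- 1)\<close>.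
\<close>

lemma Pi_pmf_count_tail:
  fixes P :: "'b \<Rightarrow> bool" and \<delta> :: real
  assumes "0 \<le> \<delta>" and p: "\<delta> \<le> measure_pmf.prob p {x. P x}" and I: "finite I"
  shows "measure_pmf.prob (Pi_pmf I dflt (\<lambda>_. p)) {z. real (card {i\<in>I. P (z i)}) < \<delta> * card I / 4}
         \<le> exp (- (\<delta> * card I / 4))"
proof -
  let ?M = "Pi_pmf I dflt (\<lambda>_. p)"
  define f where "f = (\<lambda>x. 1 - (1/2) * indicator {x. P x} x :: real)"
  define W where "W = (\<lambda>z. \<Prod>i\<in>I. f (z i))"
  have f: "0 \<le> f x" "f x \<le> 1" "f x = (if P x then 1/2 else 1)" for x
    by (auto simp: f_def indicator_def)
  have W: "W z = (1/2) ^ card {i\<in>I. P (z i)}" for z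
    using I by (simp add: W_def f(3) prod.If_cases Int_def)
  have int: "integrable p f"
    using f by (intro measure_pmf.integrable_const_bound[where B = 1]) auto
  have W01: "0 \<le> W z" "W z \<le> 1" for z
    unfolding W_def using f by (auto intro: prod_nonneg prod_le_1)
  have "measure_pmf.expectation ?M W = (\<Prod>i\<in>I. measure_pmf.expectation p f)"
    unfolding W_def using I int f(1) by (intro expectation_prod_Pi_pmf) auto
  also have "\<dots> = (1 - measure_pmf.prob p {x. P x} / 2) ^ card I"
    unfolding f_def by (simp add: measure_pmf.integrable_const_bound[where B = 1])
  also have "\<dots> \<le> (exp (- (\<delta> / 2))) ^ card I"
  proof (intro power_mono)
    have "1 - measure_pmf.prob p {x. P x} / 2 \<le> 1 - \<delta> / 2" using p by simp
    also have "\<dots> \<le> exp (- (\<delta> / 2))" using exp_ge_add_one_self[of "- (\<delta> / 2)"] by simp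
    finally show "1 - measure_pmf.prob p {x. P x} / 2 \<le> exp (- (\<delta> / 2))" .
    show "0 \<le> 1 - measure_pmf.prob p {x. P x} / 2"
      using measure_pmf.prob_le_1[of p "{x. P x}"] by linarith
  qed
  also have "\<dots> = exp (- (\<delta> * card I / 2))"
    by (simp flip: exp_of_nat_mult)
  finally have E: "measure_pmf.expectation ?M W \<le> exp (- (\<delta> * card I / 2))" .
  have "{z. real (card {i\<in>I. P (z i)}) < \<delta> * card I / 4} \<subseteq> {z \<in> space ?M. exp (- (\<delta> * card I / 4)) \<le> W z}"
  proof safe
    fix z assume less: "real (card {i\<in>I. P (z i)}) < \<delta> * card I / 4"
    have "exp (- (\<delta> * card I / 4)) \<le> exp (- card {i\<in>I. P (z i)})"
      using less by simp
    also have "\<dots> = exp (-1) ^ card {i\<in>I. P (z i)}"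
      by (simp flip: exp_of_nat_mult)
    also have "\<dots> \<le> (1/2) ^ card {i\<in>I. P (z i)}"
      using exp_ge_add_one_self[of "1::real"]
      by (intro power_mono) (auto simp: exp_minus field_simps)
    finally show "exp (- (\<delta> * card I / 4)) \<le> W z" by (simp add: W)
  qed simp
  then have "measure_pmf.prob ?M {z. real (card {i\<in>I. P (z i)}) < \<delta> * card I / 4}
      \<le> measure_pmf.prob ?M {z \<in> space ?M. exp (- (\<delta> * card I / 4)) \<le> W z}"
    by (intro measure_pmf.finite_measure_mono) auto
  also have "\<dots> \<le> measure_pmf.expectation ?M W / exp (- (\<delta> * card I / 4))"
    using W01 by (intro integral_Markov_inequality_measure[where A = "{}"]
        measure_pmf.integrable_const_bound[where B = 1]) auto
  also have "\<dots> \<le> exp (- (\<delta> * card I / 2)) / exp (- (\<delta> * card I / 4))"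
    using E by (simp add: divide_right_mono)
  also have "\<dots> = exp (- (\<delta> * card I / 4))"
    by (simp flip: exp_diff)
  finally show ?thesis .
qed

definition unbalanced :: "nat \<Rightarrow> nat \<Rightarrow> real \<Rightarrow> 'q labels set" where
  "unbalanced n T c = {z. \<exists>t\<in>{1..T}. \<exists>q. real (card {i\<in>{1..n}. z i t = q}) < c * real n}"

lemma prob_unbalanced:
  fixes \<Gamma> :: "real^('q::finite)^'q"
  assumes st: "stochastic \<Gamma>" and "0 < \<delta>" and ge: "\<And>q l. \<delta> \<le> \<Gamma> $ q $ l"
  shows "measure_pmf.prob (label_law n T \<Gamma>) (unbalanced n T (\<delta> / 4))
         \<le> T * CARD('q) * exp (- (\<delta> * n / 4))"
proof -
  let ?B = "\<lambda>(t, q). {z. real (card {i\<in>{1..n}. z i t = q}) < \<delta> * n / 4}"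
  let ?J = "{1..T} \<times> (UNIV :: 'q set)"
  have "measure_pmf.prob (label_law n T \<Gamma>) (\<Union>(?B ` ?J)) \<le> (\<Sum>j\<in>?J. measure_pmf.prob (label_law n T \<Gamma>) (?B j))"
    by (intro measure_pmf.finite_measure_subadditive_finite) auto
  also have "\<dots> \<le> (\<Sum>j\<in>?J. exp (- (\<delta> * n / 4)))"
  proof (intro sum_mono, clarify)
    fix t and q :: 'q assume t: "t \<in> {1..T}"
    have "\<delta> \<le> measure_pmf.prob (markov_path (vec_pmf (stationary \<Gamma>)) (\<lambda>q. vec_pmf (\<Gamma> $ q)) T) {w. w t = q}"
      using st ge stationary_props[OF assms] t
      by (intro markov_path_marginal_ge) (auto simp: pmf_vec_pmf stochastic_def)
    then show "measure_pmf.prob (label_law n T \<Gamma>) {z. real (card {i\<in>{1..n}. z i t = q}) < \<delta> * n / 4} \<le> exp (- (\<delta> * n / 4))"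
      using Pi_pmf_count_tail[of \<delta> _ "\<lambda>w. w t = q" "{1..n}"] \<open>0 < \<delta>\<close>
      by (simp add: label_law_def)
  qed
  finally have "measure_pmf.prob (label_law n T \<Gamma>) (\<Union>(?B ` ?J)) \<le> T * CARD('q) * exp (- (\<delta> * n / 4))"
    by simp
  moreover have "\<Union>(?B ` ?J) = unbalanced n T (\<delta> / 4)"
    by (auto simp: unbalanced_def)
  ultimately show ?thesis by simp
qed

section \<open>A likelihood bound uniform over labels and parameters\<close>

definition entries :: "(nat \<Rightarrow> real^('q::finite)^'q) \<Rightarrow> nat \<times> 'q \<times> 'q \<Rightarrow> real" where
  "entries \<pi> = (\<lambda>(t, q, l). \<pi> t $ q $ l)"

text \<open>
The success probability at an edge slot. Connectivity matrices enter as functions of time and two labels,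
so that grid points need not come from a symmetric matrix or from a valid parameter.
\<close>

definition slot_prob :: "(nat \<times> 'q \<times> 'q \<Rightarrow> real) \<Rightarrow> 'q labels \<Rightarrow> nat \<times> nat \<times> nat \<Rightarrow> real" where
  "slot_prob p z = (\<lambda>(t, i, j). p (t, z i t, z j t))"

lemma edge_slots_eq: "edge_slots n T = {s \<in> {1..T} \<times> {1..n} \<times> {1..n}. fst (snd s) < snd (snd s)}"
  by (auto simp: edge_slots_def)

lemma finite_edge_slots [simp]: "finite (edge_slots n T)"
  by (simp add: edge_slots_eq)

lemma card_edge_slots_le: "card (edge_slots n T) \<le> T * n\<^sup>2"
proof -
  have "card (edge_slots n T) \<le> card ({1..T} \<times> {1..n} \<times> {1..n})"
    by (intro card_mono) (auto simp: edge_slots_eq)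
  then show ?thesis by (simp add: power2_eq_square card_cartesian_product)
qed

definition grid :: "real \<Rightarrow> nat \<Rightarrow> real set" where
  "grid \<zeta> n = (\<lambda>k::nat. \<zeta> + k * (1 - 2 * \<zeta>) / n) ` {0..n}"

lemma grid_approx:
  assumes "x \<in> {\<zeta>..1 - \<zeta>}" "0 < \<zeta>" "\<zeta> < 1 / 2" "1 \<le> n"
  shows "\<exists>y\<in>grid \<zeta> n. \<bar>x - y\<bar> \<le> 1 / n"
proof -
  define d where "d = (1 - 2 * \<zeta>) / n"
  define k where "k = nat \<lfloor>(x - \<zeta>) / d\<rfloor>"
  have d: "0 < d" "d \<le> 1 / n"
    using assms by (auto simp: d_def divide_right_mono)
  have "0 \<le> (x - \<zeta>) / d" using assms d by simp
  then have k: "k \<le> (x - \<zeta>) / d" "(x - \<zeta>) / d < k + 1"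
    unfolding k_def by linarith+
  have "(x - \<zeta>) / d \<le> (1 - 2 * \<zeta>) / d"
    using assms d by (intro divide_right_mono) auto
  also have "\<dots> = n" using assms by (simp add: d_def)
  finally have "k \<le> n" using k by linarith
  have "k * d \<le> x - \<zeta>" "x - \<zeta> < (k + 1) * d"
    using k d by (simp_all add: field_simps)
  then have "\<bar>x - (\<zeta> + k * d)\<bar> \<le> d"
    by (simp add: algebra_simps)
  also have "\<dots> \<le> 1 / n" by (rule d)
  finally have "\<bar>x - (\<zeta> + k * (1 - 2 * \<zeta>) / n)\<bar> \<le> 1 / n" by (simp add: d_def)
  moreover have "\<zeta> + k * (1 - 2 * \<zeta>) / n \<in> grid \<zeta> n"
    using \<open>k \<le> n\<close> by (auto simp: grid_def)
  ultimately show ?thesis by blast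
qed

lemma grid_subset:
  assumes "0 < \<zeta>" "\<zeta> < 1 / 2" "1 \<le> n"
  shows "grid \<zeta> n \<subseteq> {\<zeta>..1 - \<zeta>}"
proof
  fix x assume "x \<in> grid \<zeta> n"
  then obtain k where k: "k \<le> n" "x = \<zeta> + k * ((1 - 2 * \<zeta>) / n)" by (auto simp: grid_def)
  have "k * ((1 - 2 * \<zeta>) / n) \<le> n * ((1 - 2 * \<zeta>) / n)"
    using k assms by (intro mult_right_mono) auto
  then have "k * ((1 - 2 * \<zeta>) / n) \<le> 1 - 2 * \<zeta>" using assms by simp
  moreover have "0 \<le> k * ((1 - 2 * \<zeta>) / n)" using assms by simp
  ultimately show "x \<in> {\<zeta>..1 - \<zeta>}" using k by simp
qed

lemma finite_grid [simp]: "finite (grid \<zeta> n)"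
  by (simp add: grid_def)

lemma card_grid: "card (grid \<zeta> n) \<le> n + 1"
  unfolding grid_def using card_image_le[of "{0..n}"] by simp

text \<open>
The rate \<open>c\<close> for which likelihood ratios exceed \<open>exp (c * n - S / 2)\<close> nowhere, up to probability
\<open>exp (- n)\<close>. The bracket comes from the union bound: \<open>T * ln Q\<close> counts the label arrays, \<open>T * Q\<^sup>2\<close> the
grid points, and 1 is left over for \<open>exp (- n)\<close>; it is doubled by squaring the square roots. The summands \<open>T / \<zeta>\<close> and
\<open>T\<close> pay for rounding to the grid, in the likelihood and in \<open>S\<close> respectively.
\<close>

definition excess_rate :: "nat \<Rightarrow> real \<Rightarrow> nat \<Rightarrow> real" where
  "excess_rate T \<zeta> Q = 2 * (T * ln Q + T * Q\<^sup>2 + 1) + T / \<zeta> + T"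

text \<open>
A union bound over all label arrays and all functions with values in the grid, followed by rounding. Both
families have \<open>exp (O(n))\<close> members, whereas there are order \<open>n ^ 2\<close> observations: this gap makes the
bound uniform at the price of a term of order \<open>n\<close>.
\<close>

lemma slot_likelihood_uniform_bound:
  fixes z :: "'q::finite labels" and T n :: nat and \<zeta> :: real
    and p0 :: "nat \<times> 'q \<times> 'q \<Rightarrow> real"
  defines "Ok \<equiv> {p :: nat \<times> 'q \<times> 'q \<Rightarrow> real. \<forall>t\<in>{1..T}. \<forall>q l. p (t, q, l) \<in> {\<zeta>..1 - \<zeta>}}"
  defines "I \<equiv> edge_slots n T"
  assumes \<zeta>: "0 < \<zeta>" "\<zeta> < 1 / 2" and n: "1 \<le> n" and p0: "p0 \<in> Ok"
  shows "measure_pmf.prob (Pi_pmf I False (\<lambda>s. bernoulli_pmf (slot_prob p0 z s)))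
     {y. \<exists>z'\<in>labelings n T. \<exists>p\<in>Ok.
        bernoulli_lik I (slot_prob p0 z) y *
          exp (excess_rate T \<zeta> CARD('q) * n - (\<Sum>s\<in>I. (slot_prob p z' s - slot_prob p0 z s)\<^sup>2) / 2)
        < bernoulli_lik I (slot_prob p z') y}
   \<le> exp (- real n)"
    (is "measure_pmf.prob ?M ?Bad \<le> _")
proof -
  let ?Q = "CARD('q)"
  define N where "N = PiE ({1..T} \<times> (UNIV :: 'q set) \<times> (UNIV :: 'q set)) (\<lambda>_. grid \<zeta> n)"
  define H where "H = (\<lambda>(z', p). slot_prob p z') ` ((labelings n T :: 'q labels set) \<times> N)"
  \<comment> \<open>Chosen so that the family below has at most \<open>exp (A - n)\<close> members.\<close>
  define A where "A = n * (T * ln ?Q + T * ?Q\<^sup>2 + 1)"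
  define logQ where "logQ = ln (real ?Q)"
  define g where "g = slot_prob p0 z"
  have range: "slot_prob p z' s \<in> {\<zeta>..1 - \<zeta>}" if "p \<in> Ok" "s \<in> I" for p z' s
    using that by (auto simp: Ok_def I_def slot_prob_def edge_slots_def)
  have N_Ok: "N \<subseteq> Ok"
    using grid_subset[OF \<zeta> n] by (fastforce simp: N_def Ok_def PiE_def Pi_def)
  have finN: "finite N" unfolding N_def by (intro finite_PiE) auto
  have finI: "finite I" by (simp add: I_def)
  have H: "h s \<in> {\<zeta>..1 - \<zeta>}" if hs: "h \<in> H" "s \<in> I" for h s
  proof -
    obtain z' p where "p \<in> N" "h = slot_prob p z'" using hs by (auto simp: H_def)
    then show ?thesis using range[of p s z'] N_Ok hs by blast
  qed
  have cardN: "card N \<le> (n + 1) ^ (T * ?Q\<^sup>2)"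
  proof -
    have "card N = card (grid \<zeta> n) ^ (T * ?Q\<^sup>2)"
      unfolding N_def by (subst card_PiE) (auto simp: card_cartesian_product power2_eq_square)
    then show ?thesis using power_mono[OF card_grid[of \<zeta> n] le0] by simp
  qed
  have "card H \<le> card ((labelings n T :: 'q labels set) \<times> N)"
    unfolding H_def using finN by (intro card_image_le) auto
  also have "\<dots> \<le> ?Q ^ (n * T) * (n + 1) ^ (T * ?Q\<^sup>2)"
    using cardN by (simp add: card_cartesian_product card_labelings)
  finally have "real (card H) \<le> real (?Q ^ (n * T) * (n + 1) ^ (T * ?Q\<^sup>2))"
    by (simp only: of_nat_le_iff)
  also have "\<dots> = exp logQ ^ (n * T) * (1 + real n) ^ (T * ?Q\<^sup>2)"
    by (simp add: logQ_def)
  also have "\<dots> \<le> exp logQ ^ (n * T) * exp (real n) ^ (T * ?Q\<^sup>2)"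
    by (intro mult_left_mono power_mono exp_ge_add_one_self) auto
  also have "\<dots> = exp (A - n)"
    by (simp add: A_def algebra_simps flip: exp_of_nat_mult exp_add logQ_def)
  finally have cardH: "real (card H) \<le> exp (A - n)" .
  have "?Bad \<subseteq> {y. \<exists>h\<in>H. bernoulli_lik I g y * exp (2 * A - (\<Sum>s\<in>I. (h s - g s)\<^sup>2) / 2) \<le> bernoulli_lik I h y}"
  proof safe
    fix y z' p assume z': "z' \<in> labelings n T" and p: "p \<in> Ok"
      and lt: "bernoulli_lik I (slot_prob p0 z) y *
          exp (excess_rate T \<zeta> ?Q * n - (\<Sum>s\<in>I. (slot_prob p z' s - slot_prob p0 z s)\<^sup>2) / 2)
        < bernoulli_lik I (slot_prob p z') y"
    define f where "f = slot_prob p z'"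
    have "\<forall>x\<in>{1..T} \<times> (UNIV :: 'q set) \<times> (UNIV :: 'q set). \<exists>v\<in>grid \<zeta> n. \<bar>p x - v\<bar> \<le> 1 / n"
      using p \<zeta> n by (auto simp: Ok_def intro!: grid_approx)
    then obtain v where v: "\<And>x. x \<in> {1..T} \<times> (UNIV :: 'q set) \<times> (UNIV :: 'q set) \<Longrightarrow> v x \<in> grid \<zeta> n \<and> \<bar>p x - v x\<bar> \<le> 1 / n"
      by metis
    define p' where "p' = restrict v ({1..T} \<times> (UNIV :: 'q set) \<times> (UNIV :: 'q set))"
    define h where "h = slot_prob p' z'"
    have p'N: "p' \<in> N" using v by (auto simp: N_def p'_def)
    have hH: "h \<in> H" using p'N z' by (auto simp: H_def h_def)
    have close: "\<bar>f s - h s\<bar> \<le> 1 / n" if "s \<in> I" for s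
      using v that by (auto simp: f_def h_def slot_prob_def p'_def I_def edge_slots_def)
    have fr: "f s \<in> {\<zeta>..1 - \<zeta>}" and gr: "g s \<in> {\<zeta>..1 - \<zeta>}" if "s \<in> I" for s
      using range p p0 that by (auto simp: f_def g_def)
    \<comment> \<open>The mesh \<open>1 / n\<close> is fine enough for \<open>O(n ^ 2)\<close> rounding errors to add up to \<open>O(n)\<close>.\<close>
    have cI: "card I * (1 / n) \<le> T * n"
    proof -
      have "real (card I) \<le> real (T * n\<^sup>2)"
        using card_edge_slots_le unfolding I_def of_nat_le_iff .
      then have "card I * (1 / n) \<le> T * (real n)\<^sup>2 * (1 / n)"
        by (intro mult_right_mono) auto
      then show ?thesis using n by (simp add: power2_eq_square)
    qed
    let ?Sf = "\<Sum>s\<in>I. (f s - g s)\<^sup>2" and ?Sh = "\<Sum>s\<in>I. (h s - g s)\<^sup>2"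
    have "?Sf \<le> ?Sh + card I * (2 * (1 / n))"
    proof (rule sum_sq_diff_perturb[OF finI])
      fix s assume s: "s \<in> I"
      show "g s \<in> {0..1}" "f s \<in> {0..1}" "h s \<in> {0..1}"
        using fr[OF s] gr[OF s] H[OF hH s] \<zeta> by auto
    qed (rule close)
    also have "card I * (2 * (1 / n)) = 2 * (card I * (1 / n))" by simp
    also have "?Sh + 2 * (card I * (1 / n)) \<le> ?Sh + 2 * real (T * n)"
      using cI by (intro add_left_mono mult_left_mono) auto
    finally have S: "?Sf \<le> ?Sh + 2 * real (T * n)" .
    have "card I * (1 / n / \<zeta>) = card I * (1 / n) / \<zeta>" by simp
    also have "\<dots> \<le> T * n / \<zeta>" using cI \<zeta> by (intro divide_right_mono) auto
    finally have cI': "card I * (1 / n / \<zeta>) \<le> T * n / \<zeta>" .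
    have g0: "0 < bernoulli_lik I g y" and h0: "0 < bernoulli_lik I h y"
      using gr H[OF hH] \<zeta> by (force intro!: bernoulli_lik_pos)+
    have "bernoulli_lik I g y * exp (excess_rate T \<zeta> ?Q * n - ?Sf / 2) \<le> bernoulli_lik I f y"
      using lt by (simp add: f_def g_def)
    also have "\<dots> \<le> bernoulli_lik I h y * exp (card I * (1 / n / \<zeta>))"
      by (intro bernoulli_lik_perturb[OF finI \<zeta>(1)] fr H[OF hH] close)
    also have "\<dots> \<le> bernoulli_lik I h y * exp (T * n / \<zeta>)"
      using cI' h0 by simp
    finally have 1: "bernoulli_lik I g y * exp (excess_rate T \<zeta> ?Q * n - ?Sf / 2)
        \<le> bernoulli_lik I h y * exp (T * n / \<zeta>)" .
    have e: "2 * A - ?Sh / 2 + T * n / \<zeta> \<le> excess_rate T \<zeta> ?Q * n - ?Sf / 2"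
      using S by (simp add: excess_rate_def A_def algebra_simps)
    have "bernoulli_lik I g y * exp (2 * A - ?Sh / 2) * exp (T * n / \<zeta>)
        = bernoulli_lik I g y * exp (2 * A - ?Sh / 2 + T * n / \<zeta>)"
      by (simp add: exp_add)
    also have "\<dots> \<le> bernoulli_lik I g y * exp (excess_rate T \<zeta> ?Q * n - ?Sf / 2)"
      using e g0 by simp
    also note 1
    finally have "bernoulli_lik I g y * exp (2 * A - ?Sh / 2) \<le> bernoulli_lik I h y"
      by simp
    with hH show "\<exists>h\<in>H. bernoulli_lik I g y * exp (2 * A - (\<Sum>s\<in>I. (h s - g s)\<^sup>2) / 2) \<le> bernoulli_lik I h y"
      by blast
  qed
  then have "measure_pmf.prob ?M ?Bad \<le> measure_pmf.prob ?M
     {y. \<exists>h\<in>H. bernoulli_lik I g y * exp (2 * A - (\<Sum>s\<in>I. (h s - g s)\<^sup>2) / 2) \<le> bernoulli_lik I h y}"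
    by (intro measure_pmf.finite_measure_mono) auto
  also have "\<dots> \<le> card H * exp (- A)"
    unfolding g_def
  proof (rule bernoulli_lik_ratio_family_tail[OF finI])
    show "finite H" unfolding H_def using finN by auto
    show "0 < slot_prob p0 z i \<and> slot_prob p0 z i < 1" if "i \<in> I" for i
      using range[OF p0 that, of z] \<zeta> by auto
    show "0 < h i \<and> h i < 1" if "h \<in> H" "i \<in> I" for h i
      using H[OF that] \<zeta> by auto
  qed
  also have "\<dots> \<le> exp (A - n) * exp (- A)"
    using cardH by (intro mult_right_mono) auto
  also have "\<dots> = exp (- real n)"
    by (simp flip: exp_add)
  finally show ?thesis .
qed

section \<open>The likelihood as a mixture over labels\<close>

definition edge_configs :: "nat \<Rightarrow> nat \<Rightarrow> (nat \<times> nat \<times> nat \<Rightarrow> bool) set" where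
  "edge_configs n T = PiE_dflt (edge_slots n T) False (\<lambda>_. UNIV)"

text \<open>
The upper triangle of a graph determines the graph, so likelihoods can be computed on the independent
edge indicators.
\<close>

lemma inj_on_symmetrize: "inj_on symmetrize (edge_configs n T)"
proof (rule inj_onI, rule ext)
  fix y y' and s :: "nat \<times> nat \<times> nat"
  assume y: "y \<in> edge_configs n T" and y': "y' \<in> edge_configs n T" and eq: "symmetrize y = symmetrize y'"
  obtain t i j where s: "s = (t, i, j)" by (cases s) auto
  show "y s = y' s"
  proof (cases "s \<in> edge_slots n T")
    case True
    then have "i < j" by (simp add: s edge_slots_def)
    then show ?thesis
      using fun_cong[OF fun_cong[OF fun_cong[OF eq, of t], of i], of j]
      by (simp add: symmetrize_def s)
  next
    case False
    then show ?thesis using y y' by (auto simp: s edge_configs_def PiE_dflt_def)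
  qed
qed

lemma graph_law_eq:
  "graph_law n T \<pi> z =
     map_pmf symmetrize (Pi_pmf (edge_slots n T) False (\<lambda>s. bernoulli_pmf (slot_prob (entries \<pi>) z s)))"
  unfolding graph_law_def
  by (intro arg_cong[of _ _ "map_pmf symmetrize"] Pi_pmf_cong) (auto simp: slot_prob_def entries_def)

lemma set_Pi_pmf_edges: "set_pmf (Pi_pmf (edge_slots n T) False p) \<subseteq> edge_configs n T"
  unfolding edge_configs_def by (auto simp: set_Pi_pmf PiE_dflt_def)

text \<open>
The conditions on parameters that are preserved under limits: the strict ones, that rows and diagonal entries
of the connectivity matrices are distinct, are left out.
\<close>

definition param_closure :: "nat \<Rightarrow> real \<Rightarrow> real \<Rightarrow> ('q::finite) param set" where
  "param_closure T \<delta> \<zeta> =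
     {(\<Gamma>, \<pi>).
        stochastic \<Gamma> \<and> (\<forall>q l. \<Gamma> $ q $ l \<in> {\<delta>..1 - \<delta>}) \<and>
        (\<forall>t\<in>{1..T}. transpose (\<pi> t) = \<pi> t) \<and>
        (\<forall>t\<in>{1..T}. \<forall>q l. \<pi> t $ q $ l \<in> {\<zeta>..1 - \<zeta>}) \<and>
        (\<forall>t\<in>{1..T}. \<forall>t'\<in>{1..T}. \<forall>q. \<pi> t $ q $ q = \<pi> t' $ q $ q)}"

lemma param_set_subset_closure: "param_set T \<delta> \<zeta> \<subseteq> param_closure T \<delta> \<zeta>"
  by (auto simp: param_set_def param_closure_def)

lemma symmetric_matrix_entry:
  assumes "transpose A = A"
  shows "A $ q $ l = A $ l $ q"
proof -
  have "transpose A $ q $ l = A $ l $ q" by (simp add: transpose_def)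
  then show ?thesis by (simp add: assms)
qed

text \<open>
Equal rows \<open>q\<close> and \<open>q'\<close> of a symmetric matrix would give equal diagonal entries, both being equal to the
entry at \<open>(q, q')\<close>.
\<close>

lemma param_closure_inj_diagonal:
  assumes \<theta>: "\<theta> \<in> param_closure T \<delta> \<zeta>" and inj: "\<And>t. t \<in> {1..T} \<Longrightarrow> inj (\<lambda>q. snd \<theta> t $ q $ q)"
  shows "\<theta> \<in> param_set T \<delta> \<zeta>"
proof -
  have "\<exists>l. snd \<theta> t $ q $ l \<noteq> snd \<theta> t $ q' $ l" if t: "t \<in> {1..T}" and "q \<noteq> q'" for t q q'
  proof (rule ccontr)
    assume "\<not> ?thesis"
    then have same: "snd \<theta> t $ q $ l = snd \<theta> t $ q' $ l" for l by blast
    have "transpose (snd \<theta> t) = snd \<theta> t"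
      using \<theta> t by (auto simp: param_closure_def)
    from symmetric_matrix_entry[OF this, of q' q] have "snd \<theta> t $ q $ q = snd \<theta> t $ q' $ q'"
      using same[of q] same[of q'] by simp
    with inj[OF t] \<open>q \<noteq> q'\<close> show False by (auto dest: injD)
  qed
  note rows = this
  obtain \<Gamma> \<pi> where eq: "\<theta> = (\<Gamma>, \<pi>)" by (cases \<theta>)
  show ?thesis
    using \<theta> inj rows
    unfolding eq param_closure_def param_set_def mem_Collect_eq case_prod_conv snd_conv by blast
qed

lemma param_closure_diagonal:
  assumes "\<theta> \<in> param_closure T \<delta> \<zeta>" "t \<in> {1..T}" "t' \<in> {1..T}"
  shows "snd \<theta> t $ q $ q = snd \<theta> t' $ q $ q"
proof -
  obtain \<Gamma> \<pi> where eq: "\<theta> = (\<Gamma>, \<pi>)" by (cases \<theta>)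
  show ?thesis
    using assms unfolding eq param_closure_def mem_Collect_eq case_prod_conv snd_conv by blast
qed

lemma param_set_inj_diagonal:
  assumes "\<theta> \<in> param_set T \<delta> \<zeta>" "t \<in> {1..T}"
  shows "inj (\<lambda>q. snd \<theta> t $ q $ q)"
proof -
  obtain \<Gamma> \<pi> where eq: "\<theta> = (\<Gamma>, \<pi>)" by (cases \<theta>)
  show ?thesis
    using assms unfolding eq param_set_def mem_Collect_eq case_prod_conv snd_conv by blast
qed

lemma slot_prob_in_range:
  assumes "\<theta> \<in> param_closure T \<delta> \<zeta>" "s \<in> edge_slots n T"
  shows "slot_prob (entries (snd \<theta>)) z s \<in> {\<zeta>..1 - \<zeta>}"
  using assms by (auto simp: param_closure_def slot_prob_def entries_def edge_slots_def)

lemma pmf_graph_law: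
  assumes \<theta>: "\<theta> \<in> param_closure T \<delta> \<zeta>" and \<zeta>: "0 < \<zeta>" and y: "y \<in> edge_configs n T"
  shows "pmf (graph_law n T (snd \<theta>) z) (symmetrize y)
      = bernoulli_lik (edge_slots n T) (slot_prob (entries (snd \<theta>)) z) y"
proof -
  let ?M = "Pi_pmf (edge_slots n T) False (\<lambda>s. bernoulli_pmf (slot_prob (entries (snd \<theta>)) z s))"
  have pos: "pmf (bernoulli_pmf (slot_prob (entries (snd \<theta>)) z s)) b \<noteq> 0" if "s \<in> edge_slots n T" for s b
    using slot_prob_in_range[OF \<theta> that, of z] \<zeta> pmf_bernoulli_pos[of "slot_prob (entries (snd \<theta>)) z s" b]
    by auto
  have "y \<in> set_pmf ?M"
    using y pos by (auto simp: set_Pi_pmf edge_configs_def PiE_dflt_def set_pmf_iff)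
  then have "pmf (graph_law n T (snd \<theta>) z) (symmetrize y) = pmf ?M y"
    unfolding graph_law_eq by (intro pmf_map_inj inj_on_subset[OF inj_on_symmetrize set_Pi_pmf_edges])
  also have "\<dots> = bernoulli_lik (edge_slots n T) (slot_prob (entries (snd \<theta>)) z) y"
    using y by (subst pmf_Pi') (auto simp: bernoulli_lik_def edge_configs_def PiE_dflt_def)
  finally show ?thesis .
qed

definition likelihood :: "nat \<Rightarrow> nat \<Rightarrow> ('q::finite) param \<Rightarrow> graphs \<Rightarrow> real" where
  "likelihood n T \<theta> x = pmf (map_pmf snd (model_law n T \<theta>)) x"

lemma log_likelihood_eq: "log_likelihood n T \<theta> x = ln (likelihood n T \<theta> x)"
  by (simp add: log_likelihood_def likelihood_def)

lemma likelihood_mixture: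
  assumes \<theta>: "\<theta> \<in> param_closure T \<delta> \<zeta>" and \<zeta>: "0 < \<zeta>" and y: "y \<in> edge_configs n T"
  shows "likelihood n T \<theta> (symmetrize y) =
     (\<Sum>z\<in>labelings n T. bernoulli_lik (edge_slots n T) (slot_prob (entries (snd \<theta>)) z) y * pmf (label_law n T (fst \<theta>)) z)"
proof -
  have "map_pmf snd (model_law n T \<theta>) = bind_pmf (label_law n T (fst \<theta>)) (graph_law n T (snd \<theta>))"
    by (simp add: model_law_def map_bind_pmf map_pmf_def bind_assoc_pmf bind_return_pmf bind_return_pmf')
  then have "likelihood n T \<theta> (symmetrize y)
      = measure_pmf.expectation (label_law n T (fst \<theta>)) (\<lambda>z. pmf (graph_law n T (snd \<theta>) z) (symmetrize y))"
    by (simp add: likelihood_def pmf_bind)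
  also have "\<dots> = (\<Sum>z\<in>labelings n T. pmf (graph_law n T (snd \<theta>) z) (symmetrize y) * pmf (label_law n T (fst \<theta>)) z)"
    using set_label_law by (intro integral_measure_pmf_real) auto
  finally show ?thesis
    using pmf_graph_law[OF assms] by simp
qed

lemma sum_label_law: "(\<Sum>z\<in>labelings n T. pmf (label_law n T \<Gamma>) z) = 1" for \<Gamma> :: "real^('q::finite)^'q"
  by (rule sum_pmf_eq_1) (auto intro: set_label_law[THEN subsetD])

lemma bernoulli_lik_slot_pos:
  assumes \<theta>: "\<theta> \<in> param_closure T \<delta> \<zeta>" and \<zeta>: "0 < \<zeta>"
  shows "0 < bernoulli_lik (edge_slots n T) (slot_prob (entries (snd \<theta>)) z) y"
  using slot_prob_in_range[OF \<theta>, of _ n z] \<zeta> by (intro bernoulli_lik_pos) force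

lemma likelihood_pos:
  assumes \<theta>: "\<theta> \<in> param_closure T \<delta> \<zeta>" and \<zeta>: "0 < \<zeta>" and y: "y \<in> edge_configs n T"
  shows "0 < likelihood n T \<theta> (symmetrize y)"
proof -
  obtain z where z: "z \<in> set_pmf (label_law n T (fst \<theta>))"
    using set_pmf_not_empty[of "label_law n T (fst \<theta>)"] by blast
  then have "0 < pmf (label_law n T (fst \<theta>)) z" by (simp add: pmf_positive)
  then show ?thesis
    unfolding likelihood_mixture[OF assms] using z set_label_law
    by (intro sum_pos2[of _ z]) (auto intro!: mult_pos_pos bernoulli_lik_slot_pos[OF \<theta> \<zeta>] mult_nonneg_nonneg
        less_imp_le[OF bernoulli_lik_slot_pos[OF \<theta> \<zeta>]])
qed

lemma likelihood_le_best_labeling: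
  assumes \<theta>: "\<theta> \<in> param_closure T \<delta> \<zeta>" and \<zeta>: "0 < \<zeta>" and y: "y \<in> edge_configs n T"
  shows "\<exists>z\<in>labelings n T. likelihood n T \<theta> (symmetrize y)
           \<le> bernoulli_lik (edge_slots n T) (slot_prob (entries (snd \<theta>)) z) y"
proof -
  let ?L = "\<lambda>z. bernoulli_lik (edge_slots n T) (slot_prob (entries (snd \<theta>)) z) y"
  have ne: "labelings n T \<noteq> ({} :: 'a labels set)"
    by (simp add: labelings_def paths_def)
  then have "Max (?L ` labelings n T) \<in> ?L ` labelings n T"
    by (intro Max_in) auto
  then obtain z where z: "z \<in> labelings n T" and "Max (?L ` labelings n T) = ?L z"
    by auto
  then have max: "?L z' \<le> ?L z" if "z' \<in> labelings n T" for z'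
    using that Max_ge[of "?L ` labelings n T" "?L z'"] by auto
  have "likelihood n T \<theta> (symmetrize y) \<le> (\<Sum>z'\<in>labelings n T. ?L z * pmf (label_law n T (fst \<theta>)) z')"
    unfolding likelihood_mixture[OF assms] by (intro sum_mono mult_right_mono max) auto
  also have "\<dots> = ?L z"
    by (simp add: sum_label_law flip: sum_distrib_left)
  finally show ?thesis using z by blast
qed

lemma likelihood_ge_true_labeling:
  assumes \<theta>: "\<theta> \<in> param_closure T \<delta> \<zeta>" and \<zeta>: "0 < \<zeta>" and \<delta>: "0 < \<delta>"
    and y: "y \<in> edge_configs n T" and z: "z \<in> labelings n T"
  shows "bernoulli_lik (edge_slots n T) (slot_prob (entries (snd \<theta>)) z) y * \<delta> ^ (n * T)
      \<le> likelihood n T \<theta> (symmetrize y)"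
proof -
  let ?L = "\<lambda>z. bernoulli_lik (edge_slots n T) (slot_prob (entries (snd \<theta>)) z) y"
  have "\<delta> ^ (n * T) \<le> pmf (label_law n T (fst \<theta>)) z"
    using \<theta> by (intro pmf_label_law_ge \<delta> z) (auto simp: param_closure_def)
  then have "?L z * \<delta> ^ (n * T) \<le> ?L z * pmf (label_law n T (fst \<theta>)) z"
    using bernoulli_lik_slot_pos[OF \<theta> \<zeta>] by (intro mult_left_mono) (auto intro: less_imp_le)
  also have "\<dots> \<le> (\<Sum>z\<in>labelings n T. ?L z * pmf (label_law n T (fst \<theta>)) z)"
    using z less_imp_le[OF bernoulli_lik_slot_pos[OF \<theta> \<zeta>]]
    by (intro member_le_sum) (auto intro!: mult_nonneg_nonneg)
  finally show ?thesis by (simp add: likelihood_mixture[OF \<theta> \<zeta> y])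
qed

text \<open>
The quantity \<open>S\<close> of the outline: the squared Euclidean distance between the arrays of edge probabilities of
two pairs of connectivity matrices and labels.
\<close>

definition sq_discrepancy :: "nat \<Rightarrow> nat \<Rightarrow> (nat \<Rightarrow> real^('q::finite)^'q) \<Rightarrow> 'q labels \<Rightarrow> (nat \<Rightarrow> real^'q^'q) \<Rightarrow> 'q labels \<Rightarrow> real" where
  "sq_discrepancy n T \<pi> z \<pi>' z' =
     (\<Sum>s\<in>edge_slots n T. (slot_prob (entries \<pi>') z' s - slot_prob (entries \<pi>) z s)\<^sup>2)"

text \<open>
For \<open>\<theta>\<close> at least as likely as \<open>\<theta>s\<close>, the best labels \<open>z'\<close> for \<open>\<theta>\<close> give a product that is at least
\<open>\<delta> ^ (n * T)\<close> times the true one, and the uniform bound turns this into an upper bound on the discrepancy.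
The event is phrased for graphs, as the images under \<open>symmetrize\<close> of arrays of edge indicators.
\<close>

lemma competitive_params_have_small_discrepancy:
  fixes \<theta>s :: "'q::finite param"
  assumes \<theta>s: "\<theta>s \<in> param_closure T \<delta> \<zeta>"
    and \<zeta>: "0 < \<zeta>" "\<zeta> < 1 / 2" and \<delta>: "0 < \<delta>" and n: "1 \<le> n" and z: "z \<in> labelings n T"
  shows "measure_pmf.prob (graph_law n T (snd \<theta>s) z)
     {x. \<not> (\<exists>y\<in>edge_configs n T. x = symmetrize y \<and>
          (\<forall>\<theta>\<in>param_closure T \<delta> \<zeta>. likelihood n T \<theta>s x \<le> likelihood n T \<theta> x \<longrightarrow>
            (\<exists>z'. sq_discrepancy n T (snd \<theta>s) z (snd \<theta>) z'
                  \<le> 2 * (excess_rate T \<zeta> CARD('q) + T * ln (1 / \<delta>)) * n)))}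
     \<le> exp (- real n)"
    (is "measure_pmf.prob _ {x. \<not> ?Good x} \<le> _")
proof -
  let ?I = "edge_slots n T" and ?U = "excess_rate T \<zeta> CARD('q)"
  let ?Ok = "{p :: nat \<times> 'q \<times> 'q \<Rightarrow> real. \<forall>t\<in>{1..T}. \<forall>q l. p (t, q, l) \<in> {\<zeta>..1 - \<zeta>}}"
  let ?g = "slot_prob (entries (snd \<theta>s)) z"
  let ?M = "Pi_pmf ?I False (\<lambda>s. bernoulli_pmf (?g s))"
  let ?Bad = "{y. \<exists>z'\<in>labelings n T. \<exists>p\<in>?Ok. bernoulli_lik ?I ?g y *
          exp (?U * n - (\<Sum>s\<in>?I. (slot_prob p z' s - ?g s)\<^sup>2) / 2) < bernoulli_lik ?I (slot_prob p z') y}"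
  have Ok: "entries (snd \<theta>) \<in> ?Ok" if "\<theta> \<in> param_closure T \<delta> \<zeta>" for \<theta> :: "'q param"
    using that by (auto simp: param_closure_def entries_def)
  have good: "?Good (symmetrize y)" if y: "y \<in> edge_configs n T" and "y \<notin> ?Bad" for y
  proof (intro bexI[of _ y] y conjI refl ballI impI)
    fix \<theta> :: "'q param" assume \<theta>: "\<theta> \<in> param_closure T \<delta> \<zeta>"
      and le: "likelihood n T \<theta>s (symmetrize y) \<le> likelihood n T \<theta> (symmetrize y)"
    obtain z' where z': "z' \<in> labelings n T"
      and best: "likelihood n T \<theta> (symmetrize y) \<le> bernoulli_lik ?I (slot_prob (entries (snd \<theta>)) z') y"
      using likelihood_le_best_labeling[OF \<theta> \<zeta>(1) y] by blast
    let ?S = "sq_discrepancy n T (snd \<theta>s) z (snd \<theta>) z'"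
    have g0: "0 < bernoulli_lik ?I ?g y" by (rule bernoulli_lik_slot_pos[OF \<theta>s \<zeta>(1)])
    have "bernoulli_lik ?I ?g y * \<delta> ^ (n * T) \<le> likelihood n T \<theta>s (symmetrize y)"
      by (rule likelihood_ge_true_labeling[OF \<theta>s \<zeta>(1) \<delta> y z])
    also note le
    also note best
    also have "bernoulli_lik ?I (slot_prob (entries (snd \<theta>)) z') y \<le> bernoulli_lik ?I ?g y * exp (?U * n - ?S / 2)"
    proof (rule linorder_not_less[THEN iffD1], rule notI)
      assume "bernoulli_lik ?I ?g y * exp (?U * n - ?S / 2) < bernoulli_lik ?I (slot_prob (entries (snd \<theta>)) z') y"
      then have "y \<in> ?Bad" using z' Ok[OF \<theta>] unfolding sq_discrepancy_def by blast
      with \<open>y \<notin> ?Bad\<close> show False ..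
    qed
    finally have "\<delta> ^ (n * T) \<le> exp (?U * n - ?S / 2)"
      using g0 by simp
    moreover have "\<delta> ^ (n * T) = exp (- (T * ln (1 / \<delta>) * n))"
    proof -
      have "ln (1 / \<delta>) = - ln \<delta>" using \<delta> by (simp add: ln_div)
      then have "exp (- (T * ln (1 / \<delta>) * n)) = exp (ln \<delta>) ^ (n * T)"
        by (simp add: mult_ac flip: exp_of_nat_mult)
      then show ?thesis using \<delta> by simp
    qed
    ultimately have "- (T * ln (1 / \<delta>) * n) \<le> ?U * n - ?S / 2" by simp
    then have "?S \<le> 2 * (?U + T * ln (1 / \<delta>)) * n" by (simp add: algebra_simps)
    then show "\<exists>z'. sq_discrepancy n T (snd \<theta>s) z (snd \<theta>) z' \<le> 2 * (?U + T * ln (1 / \<delta>)) * n" by blast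
  qed
  have "measure_pmf.prob (graph_law n T (snd \<theta>s) z) {x. \<not> ?Good x}
      = measure_pmf.prob ?M {y. \<not> ?Good (symmetrize y)}"
    by (simp add: graph_law_eq vimage_def)
  also have "\<dots> \<le> measure_pmf.prob ?M ?Bad"
  proof (rule measure_pmf.finite_measure_mono_AE)
    show "AE y in ?M. y \<in> {y. \<not> ?Good (symmetrize y)} \<longrightarrow> y \<in> ?Bad"
      unfolding AE_measure_pmf_iff
    proof (intro ballI impI, rule ccontr)
      fix y assume y: "y \<in> set_pmf ?M" and notgood: "y \<in> {y. \<not> ?Good (symmetrize y)}" and notbad: "y \<notin> ?Bad"
      have "y \<in> edge_configs n T" using y set_Pi_pmf_edges by (rule subsetD[rotated])
      from good[OF this notbad] notgood show False
        unfolding mem_Collect_eq by (rule notE[rotated])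
    qed
  qed simp
  also have "\<dots> \<le> exp (- real n)"
    by (rule slot_likelihood_uniform_bound[OF \<zeta> n Ok[OF \<theta>s]])
  finally show ?thesis .
qed

section \<open>Existence of maximizers on the compact enlargement\<close>

text \<open>
Coordinates \<open>(\<alpha>, \<Gamma>, \<pi>)\<close> in which the likelihood is visibly continuous: the stationary law is a coordinate of its
own, tied to \<open>\<Gamma>\<close> by the closed condition of invariance. Plain functions are used in place of vectors because Tychonoff's theorem then gives compactness, although there are infinitely
many times.
\<close>

type_synonym 'q coords = "('q \<Rightarrow> real) \<times> ('q \<times> 'q \<Rightarrow> real) \<times> (nat \<times> 'q \<times> 'q \<Rightarrow> real)"

lemma compact_function_box: "compact {f :: 'i \<Rightarrow> real. \<forall>i. f i \<in> {a..b}}"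
proof -
  have "compactin (product_topology (\<lambda>_ :: 'i. euclideanreal) UNIV) (PiE UNIV (\<lambda>_ :: 'i. {a..b}))"
    by (simp add: compactin_PiE)
  then have "compact (PiE UNIV (\<lambda>_ :: 'i. {a..b}))"
    by (simp add: euclidean_product_topology)
  moreover have "PiE UNIV (\<lambda>_ :: 'i. {a..b}) = {f. \<forall>i. f i \<in> {a..b}}"
    by (auto simp: PiE_def)
  ultimately show ?thesis by simp
qed

definition coord_set :: "real \<Rightarrow> real \<Rightarrow> ('q::finite) coords set" where
  "coord_set \<delta> \<zeta> =
     {f. \<forall>i. f i \<in> {0..1}} \<times> {f. \<forall>i. f i \<in> {\<delta>..1 - \<delta>}} \<times> {f. \<forall>i. f i \<in> {\<zeta>..1 - \<zeta>}} \<inter>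
     {u. (\<Sum>q\<in>UNIV. fst u q) = 1 \<and> (\<forall>l. (\<Sum>q\<in>UNIV. fst (snd u) (q, l) * fst u q) = fst u l) \<and>
         (\<forall>q. (\<Sum>l\<in>UNIV. fst (snd u) (q, l)) = 1) \<and>
         (\<forall>t q l. snd (snd u) (t, q, l) = snd (snd u) (t, l, q)) \<and>
         (\<forall>t t' q. snd (snd u) (t, q, q) = snd (snd u) (t', q, q))}"

lemma continuous_coords:
  fixes S :: "('q::finite) coords set"
  shows "continuous_on S (\<lambda>u. fst u q)" "continuous_on S (\<lambda>u. fst (snd u) ql)" "continuous_on S (\<lambda>u. snd (snd u) x)"
proof -
  have "continuous_on S (\<lambda>u. fst u)" "continuous_on S (\<lambda>u. fst (snd u))" "continuous_on S (\<lambda>u. snd (snd u))"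
    by (intro continuous_on_fst continuous_on_snd continuous_on_id)+
  from this[THEN continuous_on_product_then_coordinatewise]
  show "continuous_on S (\<lambda>u. fst u q)" "continuous_on S (\<lambda>u. fst (snd u) ql)" "continuous_on S (\<lambda>u. snd (snd u) x)"
    by this+
qed

lemma compact_coord_set: "compact (coord_set \<delta> \<zeta> :: ('q::finite) coords set)"
  unfolding coord_set_def
proof (rule compact_Int_closed)
  show "compact ({f :: 'q \<Rightarrow> real. \<forall>i. f i \<in> {0..1}} \<times> {f :: 'q \<times> 'q \<Rightarrow> real. \<forall>i. f i \<in> {\<delta>..1 - \<delta>}} \<times>
      {f :: nat \<times> 'q \<times> 'q \<Rightarrow> real. \<forall>i. f i \<in> {\<zeta>..1 - \<zeta>}})"
    by (intro compact_Times compact_function_box)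
  have sums: "continuous_on UNIV (\<lambda>u :: 'q coords. \<Sum>q\<in>UNIV. fst u q)"
    "continuous_on UNIV (\<lambda>u :: 'q coords. \<Sum>q\<in>UNIV. fst (snd u) (q, l) * fst u q)"
    "continuous_on UNIV (\<lambda>u :: 'q coords. \<Sum>l\<in>UNIV. fst (snd u) (q, l))" for l q
    by (rule continuous_on_sum continuous_on_mult continuous_coords)+
  show "closed {u :: 'q coords. (\<Sum>q\<in>UNIV. fst u q) = 1 \<and>
         (\<forall>l. (\<Sum>q\<in>UNIV. fst (snd u) (q, l) * fst u q) = fst u l) \<and>
         (\<forall>q. (\<Sum>l\<in>UNIV. fst (snd u) (q, l)) = 1) \<and>
         (\<forall>t q l. snd (snd u) (t, q, l) = snd (snd u) (t, l, q)) \<and>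
         (\<forall>t t' q. snd (snd u) (t, q, q) = snd (snd u) (t', q, q))}"
    by (intro closed_Collect_conj closed_Collect_all closed_Collect_eq sums continuous_coords continuous_on_const)
qed

definition coord_likelihood :: "nat \<Rightarrow> nat \<Rightarrow> (nat \<times> nat \<times> nat \<Rightarrow> bool) \<Rightarrow> ('q::finite) coords \<Rightarrow> real" where
  "coord_likelihood n T y u =
     (\<Sum>z\<in>labelings n T.
        (\<Prod>(t, i, j)\<in>edge_slots n T.
           if y (t, i, j) then snd (snd u) (t, z i t, z j t) else 1 - snd (snd u) (t, z i t, z j t)) *
        (\<Prod>i\<in>{1..n}. \<Prod>t\<in>{1..T}. if t = 1 then fst u (z i t) else fst (snd u) (z i (t - 1), z i t)))"

lemma continuous_coord_likelihood: "continuous_on S (coord_likelihood n T y)"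
proof -
  have edge: "continuous_on S (\<lambda>u. case s of (t, i, j) \<Rightarrow>
      if y (t, i, j) then snd (snd u) (t, z i t, z j t) else 1 - snd (snd u) (t, z i t, z j t))" for s z
    by (cases s; cases "y s") (auto intro!: continuous_on_diff continuous_on_const continuous_coords)
  have label: "continuous_on S (\<lambda>u. if t = 1 then fst u (z i t) else fst (snd u) (z i (t - 1), z i t))" for t i z
    by (cases "t = 1") (auto intro!: continuous_coords)
  show ?thesis
    unfolding coord_likelihood_def
    by (intro continuous_on_sum continuous_on_mult continuous_on_prod edge label)
qed

lemma likelihood_eq_coord_likelihood:
  fixes \<theta> :: "'q::finite param"
  assumes \<theta>: "\<theta> \<in> param_closure T \<delta> \<zeta>" and \<zeta>: "0 < \<zeta>" and \<delta>: "0 < \<delta>" and y: "y \<in> edge_configs n T"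
    and a: "\<And>q. fst u q = stationary (fst \<theta>) $ q"
    and g: "\<And>q l. fst (snd u) (q, l) = fst \<theta> $ q $ l"
    and p: "\<And>t q l. t \<in> {1..T} \<Longrightarrow> snd (snd u) (t, q, l) = snd \<theta> t $ q $ l"
  shows "likelihood n T \<theta> (symmetrize y) = coord_likelihood n T y u"
proof -
  have st: "stochastic (fst \<theta>)" and ge: "\<And>q l. \<delta> \<le> fst \<theta> $ q $ l"
    using \<theta> by (auto simp: param_closure_def)
  have edge: "bernoulli_lik (edge_slots n T) (slot_prob (entries (snd \<theta>)) z) y =
      (\<Prod>(t, i, j)\<in>edge_slots n T.
           if y (t, i, j) then snd (snd u) (t, z i t, z j t) else 1 - snd (snd u) (t, z i t, z j t))" for z
    unfolding bernoulli_lik_def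
  proof (intro prod.cong refl)
    fix s assume s: "s \<in> edge_slots n T"
    obtain t i j where sij: "s = (t, i, j)" by (cases s) auto
    have "t \<in> {1..T}" using s by (simp add: sij edge_slots_def)
    moreover have "0 \<le> slot_prob (entries (snd \<theta>)) z s" "slot_prob (entries (snd \<theta>)) z s \<le> 1"
      using slot_prob_in_range[OF \<theta> s, of z] \<zeta> by auto
    ultimately show "pmf (bernoulli_pmf (slot_prob (entries (snd \<theta>)) z s)) (y s) = (case s of (t, i, j) \<Rightarrow>
           if y (t, i, j) then snd (snd u) (t, z i t, z j t) else 1 - snd (snd u) (t, z i t, z j t))"
      by (cases "y s") (simp_all add: sij p slot_prob_def entries_def)
  qed
  have label: "pmf (label_law n T (fst \<theta>)) z =
      (\<Prod>i\<in>{1..n}. \<Prod>t\<in>{1..T}. if t = 1 then fst u (z i t) else fst (snd u) (z i (t - 1), z i t))"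
    if z: "z \<in> labelings n T" for z
    unfolding pmf_label_law[OF z] using stationary_props(1)[OF st \<delta> ge] st
    by (intro prod.cong refl) (simp add: a g pmf_vec_pmf stochastic_def)
  show ?thesis
    unfolding likelihood_mixture[OF \<theta> \<zeta> y] coord_likelihood_def
    by (intro sum.cong refl) (simp add: edge label)
qed

text \<open>
Connectivity matrices at times outside \<open>{1..T}\<close> are arbitrary in a parameter; they are replaced by the one
at time 1 so that the coordinates stay in a compact set.
\<close>

definition to_coords :: "nat \<Rightarrow> ('q::finite) param \<Rightarrow> 'q coords" where
  "to_coords T \<theta> = (\<lambda>q. stationary (fst \<theta>) $ q, \<lambda>(q, l). fst \<theta> $ q $ l,
     \<lambda>(t, q, l). snd \<theta> (if t \<in> {1..T} then t else 1) $ q $ l)"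

definition of_coords :: "('q::finite) coords \<Rightarrow> 'q param" where
  "of_coords u = (\<chi> q l. fst (snd u) (q, l), \<lambda>t. \<chi> q l. snd (snd u) (t, q, l))"

lemma to_coords_preserves_likelihood:
  fixes \<theta> :: "'q::finite param"
  assumes T: "1 \<le> T" and \<theta>: "\<theta> \<in> param_closure T \<delta> \<zeta>" and \<zeta>: "0 < \<zeta>" and \<delta>: "0 < \<delta>"
    and y: "y \<in> edge_configs n T"
  shows "to_coords T \<theta> \<in> coord_set \<delta> \<zeta>"
    and "likelihood n T \<theta> (symmetrize y) = coord_likelihood n T y (to_coords T \<theta>)"
proof -
  have st: "stochastic (fst \<theta>)" and ge: "\<And>q l. \<delta> \<le> fst \<theta> $ q $ l" "\<And>q l. fst \<theta> $ q $ l \<le> 1 - \<delta>"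
    using \<theta> by (auto simp: param_closure_def)
  have sym: "transpose (snd \<theta> t) = snd \<theta> t" and range: "snd \<theta> t $ q $ l \<in> {\<zeta>..1 - \<zeta>}"
    if "t \<in> {1..T}" for t q l
    using \<theta> that by (auto simp: param_closure_def)
  note diag = param_closure_diagonal[OF \<theta>]
  note stat = stationary_props[OF st \<delta> ge(1)]
  have sym': "snd \<theta> t $ q $ l = snd \<theta> t $ l $ q" if "t \<in> {1..T}" for t q l
    by (rule symmetric_matrix_entry[OF sym[OF that]])
  have inv: "(\<Sum>q\<in>UNIV. fst \<theta> $ q $ l * stationary (fst \<theta>) $ q) = stationary (fst \<theta>) $ l" for l
    using arg_cong[OF stat(2), of "\<lambda>v. v $ l"] by (simp add: vector_matrix_mult_def mult.commute)
  have le1: "stationary (fst \<theta>) $ q \<le> 1" for q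
    using stat(1) unfolding prob_vector_def by (metis (no_types, lifting) UNIV_I finite member_le_sum)
  have T1: "(if t \<in> {1..T} then t else 1) \<in> {1..T}" for t using T by auto
  have e1: "fst (to_coords T \<theta>) q = stationary (fst \<theta>) $ q" and e2: "fst (snd (to_coords T \<theta>)) (q, l) = fst \<theta> $ q $ l"
    and e3: "snd (snd (to_coords T \<theta>)) (t, q, l) = snd \<theta> (if t \<in> {1..T} then t else 1) $ q $ l" for t q l
    by (simp_all add: to_coords_def)
  show "to_coords T \<theta> \<in> coord_set \<delta> \<zeta>"
    unfolding coord_set_def mem_Times_iff Int_iff mem_Collect_eq
  proof (intro conjI allI)
    show "fst (to_coords T \<theta>) q \<in> {0..1}" for q using stat(1) le1 by (simp add: e1 prob_vector_def)
    show "fst (snd (to_coords T \<theta>)) x \<in> {\<delta>..1 - \<delta>}" for x using ge by (cases x) (simp add: e2)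
    show "snd (snd (to_coords T \<theta>)) x \<in> {\<zeta>..1 - \<zeta>}" for x using range[OF T1] by (cases x) (simp only: e3)
    show "(\<Sum>q\<in>UNIV. fst (to_coords T \<theta>) q) = 1" using stat(1) by (simp add: e1 prob_vector_def)
    show "(\<Sum>q\<in>UNIV. fst (snd (to_coords T \<theta>)) (q, l) * fst (to_coords T \<theta>) q) = fst (to_coords T \<theta>) l" for l
      unfolding e1 e2 by (rule inv)
    show "(\<Sum>l\<in>UNIV. fst (snd (to_coords T \<theta>)) (q, l)) = 1" for q
      using st by (simp add: e2 stochastic_def prob_vector_def)
    show "snd (snd (to_coords T \<theta>)) (t, q, l) = snd (snd (to_coords T \<theta>)) (t, l, q)" for t q l
      unfolding e3 by (rule sym'[OF T1])
    show "snd (snd (to_coords T \<theta>)) (t, q, q) = snd (snd (to_coords T \<theta>)) (t', q, q)" for t t' q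
      unfolding e3 by (rule diag[OF T1 T1])
  qed
  show "likelihood n T \<theta> (symmetrize y) = coord_likelihood n T y (to_coords T \<theta>)"
    by (rule likelihood_eq_coord_likelihood[OF \<theta> \<zeta> \<delta> y]) (auto simp: to_coords_def)
qed

lemma of_coords_preserves_likelihood:
  fixes u :: "'q::finite coords"
  assumes u: "u \<in> coord_set \<delta> \<zeta>" and \<zeta>: "0 < \<zeta>" and \<delta>: "0 < \<delta>"
    and y: "y \<in> edge_configs n T"
  shows "of_coords u \<in> param_closure T \<delta> \<zeta>"
    and "likelihood n T (of_coords u) (symmetrize y) = coord_likelihood n T y u"
proof -
  note u' = u[unfolded coord_set_def mem_Times_iff Int_iff mem_Collect_eq]
  from u' have a1: "\<forall>q. fst u q \<in> {0..1}" by (elim conjE)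
  from u' have g1: "\<forall>x. fst (snd u) x \<in> {\<delta>..1 - \<delta>}" by (elim conjE)
  from u' have p1: "\<forall>x. snd (snd u) x \<in> {\<zeta>..1 - \<zeta>}" by (elim conjE)
  from u' have sum_a: "(\<Sum>q\<in>UNIV. fst u q) = 1" by (elim conjE)
  from u' have inv: "\<forall>l. (\<Sum>q\<in>UNIV. fst (snd u) (q, l) * fst u q) = fst u l" by (elim conjE)
  from u' have row: "\<forall>q. (\<Sum>l\<in>UNIV. fst (snd u) (q, l)) = 1" by (elim conjE)
  from u' have sym: "\<forall>t q l. snd (snd u) (t, q, l) = snd (snd u) (t, l, q)" by (elim conjE)
  from u' have diag: "\<forall>t t' q. snd (snd u) (t, q, q) = snd (snd u) (t', q, q)" by (elim conjE)
  have a: "\<And>q. 0 \<le> fst u q" and g: "\<And>x. fst (snd u) x \<in> {\<delta>..1 - \<delta>}"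
    and p: "\<And>x. snd (snd u) x \<in> {\<zeta>..1 - \<zeta>}"
    using a1 g1 p1 by auto
  have g0: "0 \<le> fst (snd u) x" for x using g[of x] \<delta> by simp
  have st: "stochastic (fst (of_coords u))"
    using row g0 by (simp add: stochastic_def prob_vector_def of_coords_def)
  show cl: "of_coords u \<in> param_closure T \<delta> \<zeta>"
    unfolding param_closure_def mem_Collect_eq case_prod_unfold
  proof (intro conjI ballI allI)
    show "stochastic (fst (of_coords u))" by (rule st)
    show "fst (of_coords u) $ q $ l \<in> {\<delta>..1 - \<delta>}" for q l using g by (simp add: of_coords_def)
    show "transpose (snd (of_coords u) t) = snd (of_coords u) t" for t
      by (simp add: of_coords_def transpose_def vec_eq_iff) (intro allI, rule sym[rule_format])
    show "snd (of_coords u) t $ q $ l \<in> {\<zeta>..1 - \<zeta>}" for t q l using p by (simp add: of_coords_def)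
    show "snd (of_coords u) t $ q $ q = snd (of_coords u) t' $ q $ q" for t t' q
      by (simp add: of_coords_def) (rule diag[rule_format])
  qed
  have "stationary (fst (of_coords u)) = (\<chi> q. fst u q)"
  proof (rule stationary_eqI[OF st \<delta>])
    show "\<delta> \<le> fst (of_coords u) $ q $ l" for q l using g[of "(q, l)"] by (simp add: of_coords_def)
    show "prob_vector (\<chi> q. fst u q)" using a sum_a by (simp add: prob_vector_def)
    show "(\<chi> q. fst u q) v* fst (of_coords u) = (\<chi> q. fst u q)"
      using inv by (simp add: vec_eq_iff vector_matrix_mult_def of_coords_def mult.commute)
  qed
  then show "likelihood n T (of_coords u) (symmetrize y) = coord_likelihood n T y u"
    by (intro likelihood_eq_coord_likelihood[OF cl \<zeta> \<delta> y]) (auto simp: of_coords_def)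
qed

text \<open>
A continuous function on a compact set attains its supremum; the correspondence between coordinates and
parameters preserves likelihoods in both directions because the stationary law is unique.
\<close>

lemma likelihood_maximizer_exists:
  fixes \<theta>s :: "'q::finite param"
  assumes T: "1 \<le> T" and \<theta>s: "\<theta>s \<in> param_closure T \<delta> \<zeta>" and \<zeta>: "0 < \<zeta>" and \<delta>: "0 < \<delta>"
    and y: "y \<in> edge_configs n T"
  shows "\<exists>\<theta>\<in>(param_closure T \<delta> \<zeta> :: 'q param set). \<forall>\<theta>'\<in>(param_closure T \<delta> \<zeta> :: 'q param set).
     likelihood n T \<theta>' (symmetrize y) \<le> likelihood n T \<theta> (symmetrize y)"
proof -
  have "coord_set \<delta> \<zeta> \<noteq> ({} :: 'q coords set)" using to_coords_preserves_likelihood(1)[OF T \<theta>s \<zeta> \<delta> y] by blast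
  from continuous_attains_sup[OF compact_coord_set this continuous_coord_likelihood[of _ n T y]]
  obtain u :: "'q coords" where u: "u \<in> coord_set \<delta> \<zeta>"
    and max: "\<forall>v\<in>(coord_set \<delta> \<zeta> :: 'q coords set). coord_likelihood n T y v \<le> coord_likelihood n T y u"
    by (rule bexE)
  show ?thesis
  proof (intro bexI[of _ "of_coords u"] ballI)
    fix \<theta>' :: "'q param" assume \<theta>': "\<theta>' \<in> param_closure T \<delta> \<zeta>"
    show "likelihood n T \<theta>' (symmetrize y) \<le> likelihood n T (of_coords u) (symmetrize y)"
      unfolding to_coords_preserves_likelihood(2)[OF T \<theta>' \<zeta> \<delta> y] of_coords_preserves_likelihood(2)[OF u \<zeta> \<delta> y]
      by (rule bspec[OF max to_coords_preserves_likelihood(1)[OF T \<theta>' \<zeta> \<delta> y]])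
  qed (rule of_coords_preserves_likelihood(1)[OF u \<zeta> \<delta> y])
qed

section \<open>From small discrepancy to matching parameters\<close>

lemma sum_over_ordered_pairs:
  fixes F :: "nat \<Rightarrow> nat \<Rightarrow> real"
  assumes sym: "\<And>i j. F i j = F j i"
  shows "(\<Sum>(i, j)\<in>{(i, j). i \<in> {1..n} \<and> j \<in> {1..n} \<and> i \<noteq> j}. F i j)
       = 2 * (\<Sum>(i, j)\<in>{(i, j). i \<in> {1..n} \<and> j \<in> {1..n} \<and> i < j}. F i j)"
proof -
  let ?U = "{(i, j). i \<in> {1..n} \<and> j \<in> {1..n} \<and> i < j}"
  have fin: "finite ?U" by (rule finite_subset[of _ "{1..n} \<times> {1..n}"]) auto
  have "{(i, j). i \<in> {1..n} \<and> j \<in> {1..n} \<and> i \<noteq> j} = ?U \<union> prod.swap ` ?U"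
    by (force simp: image_iff)
  moreover have "?U \<inter> prod.swap ` ?U = {}" by auto
  moreover have "(\<Sum>(i, j)\<in>prod.swap ` ?U. F i j) = (\<Sum>(i, j)\<in>?U. F i j)"
    by (subst sum.reindex) (auto intro!: sum.cong sym)
  ultimately show ?thesis
    using fin by (simp add: sum.union_disjoint)
qed

lemma majority_label:
  fixes f :: "'i \<Rightarrow> 'q::finite"
  assumes "finite C"
  shows "\<exists>m. card C \<le> CARD('q) * card {i\<in>C. f i = m}"
proof (rule ccontr)
  assume "\<not> ?thesis"
  then have less: "CARD('q) * card {i\<in>C. f i = m} < card C" for m
    by (simp add: not_le)
  have "CARD('q) * card C = CARD('q) * (\<Sum>m\<in>UNIV. card {i\<in>C. f i = m})"
  proof -
    have "card C = (\<Sum>m\<in>UNIV. \<Sum>i\<in>{i\<in>C. f i = m}. 1)"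
      using sum.group[OF assms, of UNIV f "\<lambda>_. 1::nat"] by simp
    then show ?thesis by simp
  qed
  also have "\<dots> = (\<Sum>m\<in>UNIV. CARD('q) * card {i\<in>C. f i = m})"
    by (simp add: sum_distrib_left)
  also have "\<dots> < (\<Sum>m\<in>(UNIV :: 'q set). card C)"
    using less by (intro sum_strict_mono) auto
  finally show False by simp
qed

text \<open>
Let \<open>\<sigma> q\<close> be the most frequent value of \<open>z'\<close> on the class \<open>q\<close> of \<open>z\<close>; it occurs at \<open>m\<close> nodes at least. The
pairs of such nodes in the classes \<open>q\<close> and \<open>l\<close> all contribute the same square
\<open>(b (\<sigma> q) (\<sigma> l) - a q l)\<^sup>2\<close> to the sum, and there are at least \<open>m * (m - 1) \<ge> m\<^sup>2 / 2\<close> ordered ones.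
\<close>

lemma labels_match_up_to_relabeling:
  fixes z z' :: "nat \<Rightarrow> 'q::finite" and a b :: "'q \<Rightarrow> 'q \<Rightarrow> real" and m S :: real
  assumes sym: "\<And>q l. a q l = a l q" "\<And>q l. b q l = b l q"
    and size: "\<And>q. CARD('q) * m \<le> real (card {i\<in>{1..n}. z i = q})" and m: "2 \<le> m"
    and S: "(\<Sum>(i, j)\<in>{(i, j). i \<in> {1..n} \<and> j \<in> {1..n} \<and> i < j}. (b (z' i) (z' j) - a (z i) (z j))\<^sup>2) \<le> S"
  shows "\<exists>\<sigma>. \<forall>q l. (b (\<sigma> q) (\<sigma> l) - a q l)\<^sup>2 * m\<^sup>2 \<le> 4 * S"
proof -
  have "\<forall>q. \<exists>k. card {i\<in>{1..n}. z i = q} \<le> CARD('q) * card {i\<in>{i\<in>{1..n}. z i = q}. z' i = k}"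
    by (intro allI majority_label) auto
  from choice[OF this] obtain \<sigma>
    where \<sigma>: "\<forall>q. card {i\<in>{1..n}. z i = q} \<le> CARD('q) * card {i\<in>{i\<in>{1..n}. z i = q}. z' i = \<sigma> q}"
    by blast
  define A where "A = (\<lambda>q. {i\<in>{i\<in>{1..n}. z i = q}. z' i = \<sigma> q})"
  have finA: "finite (A q)" for q by (simp add: A_def)
  have cardA: "m \<le> card (A q)" for q
  proof -
    have "real CARD('q) * m \<le> real (CARD('q) * card (A q))"
      using size[of q] spec[OF \<sigma>, of q] unfolding A_def by linarith
    then show ?thesis by simp
  qed
  have "(b (\<sigma> q) (\<sigma> l) - a q l)\<^sup>2 * m\<^sup>2 \<le> 4 * S" for q l
  proof -
    let ?F = "\<lambda>i j. (b (z' i) (z' j) - a (z i) (z j))\<^sup>2"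
    let ?P = "SIGMA i:A q. A l - {i}"
    \<comment> \<open>A node may belong to both classes (if \<open>q = l\<close>) but is not paired with itself.\<close>
    have "m * (m - 1) \<le> real (card (A q)) * (real (card (A l)) - 1)"
      using cardA[of q] cardA[of l] m by (intro mult_mono) auto
    also have "\<dots> = (\<Sum>i\<in>A q. real (card (A l)) - 1)" by simp
    also have "\<dots> \<le> (\<Sum>i\<in>A q. real (card (A l - {i})))"
      using finA by (intro sum_mono) (auto simp: card_Diff_singleton_if)
    also have "\<dots> = card ?P"
      using finA by (subst card_SigmaI) auto
    finally have cardP: "m * (m - 1) \<le> card ?P" .
    have "2 * m \<le> m * m" using m by (intro mult_right_mono) auto
    then have "m * m / 2 \<le> m * (m - 1)" by (simp add: right_diff_distrib)
    then have "m\<^sup>2 / 2 \<le> card ?P" using cardP by (simp add: power2_eq_square)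
    then have "(b (\<sigma> q) (\<sigma> l) - a q l)\<^sup>2 * (m\<^sup>2 / 2) \<le> (b (\<sigma> q) (\<sigma> l) - a q l)\<^sup>2 * card ?P"
      by (intro mult_left_mono) auto
    also have "\<dots> = (\<Sum>(i, j)\<in>?P. ?F i j)"
    proof -
      have "(\<Sum>(i, j)\<in>?P. ?F i j) = (\<Sum>_\<in>?P. (b (\<sigma> q) (\<sigma> l) - a q l)\<^sup>2)"
        by (intro sum.cong refl) (auto simp: A_def)
      then show ?thesis by simp
    qed
    also have "\<dots> \<le> (\<Sum>(i, j)\<in>{(i, j). i \<in> {1..n} \<and> j \<in> {1..n} \<and> i \<noteq> j}. ?F i j)"
      by (intro sum_mono2 finite_subset[of "{(i, j). i \<in> {1..n} \<and> j \<in> {1..n} \<and> i \<noteq> j}" "{1..n} \<times> {1..n}"])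
        (auto simp: A_def)
    also have "\<dots> = 2 * (\<Sum>(i, j)\<in>{(i, j). i \<in> {1..n} \<and> j \<in> {1..n} \<and> i < j}. ?F i j)"
      using sym by (intro sum_over_ordered_pairs) metis
    also have "\<dots> \<le> 2 * S" using S by simp
    finally show ?thesis by simp
  qed
  then show ?thesis by blast
qed

lemma matching_at_each_time:
  fixes \<theta>s \<theta> :: "'q::finite param" and c C :: real
  assumes \<theta>s: "\<theta>s \<in> param_closure T \<delta> \<zeta>" and \<theta>: "\<theta> \<in> param_closure T \<delta> \<zeta>" and t: "t \<in> {1..T}"
    and bal: "z \<notin> unbalanced n T c" and n: "2 * CARD('q) \<le> c * n"
    and S: "sq_discrepancy n T (snd \<theta>s) z (snd \<theta>) z' \<le> C * n"
  shows "\<exists>\<sigma>. \<forall>q l. \<bar>snd \<theta>s t $ q $ l - snd \<theta> t $ \<sigma> q $ \<sigma> l\<bar> \<le> sqrt (4 * C * (CARD('q))\<^sup>2 / c\<^sup>2 / n)"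
proof -
  define m where "m = c * n / CARD('q)"
  have m: "2 \<le> m" using n by (simp add: m_def field_simps)
  let ?E = "{(i, j). i \<in> {1..n} \<and> j \<in> {1..n} \<and> i < j}"
  let ?f = "\<lambda>s. (slot_prob (entries (snd \<theta>)) z' s - slot_prob (entries (snd \<theta>s)) z s)\<^sup>2"
  have "(\<Sum>(i, j)\<in>?E. (snd \<theta> t $ z' i t $ z' j t - snd \<theta>s t $ z i t $ z j t)\<^sup>2) = sum ?f (Pair t ` ?E)"
    by (subst sum.reindex) (auto simp: inj_on_def slot_prob_def entries_def intro!: sum.cong)
  also have "\<dots> \<le> sum ?f (edge_slots n T)"
    using t by (intro sum_mono2) (auto simp: edge_slots_def[symmetric] finite_edge_slots, auto simp: edge_slots_def)
  also have "\<dots> \<le> C * n"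
    using S by (simp add: sq_discrepancy_def)
  finally have S': "(\<Sum>(i, j)\<in>?E. (snd \<theta> t $ z' i t $ z' j t - snd \<theta>s t $ z i t $ z j t)\<^sup>2) \<le> C * n" .
  have sym: "transpose (snd \<theta>s t) = snd \<theta>s t" "transpose (snd \<theta> t) = snd \<theta> t"
    using \<theta>s \<theta> t by (auto simp: param_closure_def)
  have size: "CARD('q) * m \<le> real (card {i\<in>{1..n}. z i t = q})" for q
    using bal t by (auto simp: unbalanced_def m_def not_less)
  obtain \<sigma> where \<sigma>: "\<And>q l. (snd \<theta> t $ \<sigma> q $ \<sigma> l - snd \<theta>s t $ q $ l)\<^sup>2 * m\<^sup>2 \<le> 4 * (C * n)"
    using labels_match_up_to_relabeling[OF symmetric_matrix_entry[OF sym(1)] symmetric_matrix_entry[OF sym(2)] size m S']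
    by blast
  have n0: "0 < real n" and c0: "c \<noteq> 0" using n by (auto simp: not_le intro!: gr0I)
  have "\<bar>snd \<theta>s t $ q $ l - snd \<theta> t $ \<sigma> q $ \<sigma> l\<bar> \<le> sqrt (4 * C * (CARD('q))\<^sup>2 / c\<^sup>2 / n)" for q l
  proof (rule real_le_rsqrt)
    have "\<bar>snd \<theta>s t $ q $ l - snd \<theta> t $ \<sigma> q $ \<sigma> l\<bar>\<^sup>2 \<le> 4 * (C * n) / m\<^sup>2"
      using \<sigma>[of q l] m by (simp add: pos_le_divide_eq power2_commute)
    also have "\<dots> = 4 * C * (CARD('q))\<^sup>2 / c\<^sup>2 / n"
      using n0 c0 by (simp add: m_def power_divide power_mult_distrib) (simp add: power2_eq_square)
    finally show "\<bar>snd \<theta>s t $ q $ l - snd \<theta> t $ \<sigma> q $ \<sigma> l\<bar>\<^sup>2 \<le> 4 * C * (CARD('q))\<^sup>2 / c\<^sup>2 / n" .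
  qed
  then show ?thesis by blast
qed

text \<open>
Diagonal entries identify labels: if \<open>\<sigma> t q = \<sigma> t' q'\<close>, then the true diagonal entries of \<open>q\<close> and \<open>q'\<close> are both
within \<open>d\<close> of the same entry of \<open>\<theta>\<close>, so \<open>q = q'\<close> by the gap. This yields injectivity (with \<open>t = t'\<close>),
independence of time, and the distinctness of the diagonal entries of \<open>\<theta>\<close>.
\<close>

lemma relabelings_agree:
  fixes \<theta>s \<theta> :: "'q::finite param"
  assumes T: "1 \<le> T" and \<theta>s: "\<theta>s \<in> param_closure T \<delta> \<zeta>" and \<theta>: "\<theta> \<in> param_closure T \<delta> \<zeta>"
    and gap: "\<And>q q'. q \<noteq> q' \<Longrightarrow> 2 * d < \<bar>snd \<theta>s 1 $ q $ q - snd \<theta>s 1 $ q' $ q'\<bar>"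
    and match: "\<And>t. t \<in> {1..T} \<Longrightarrow> \<exists>\<sigma>. \<forall>q l. \<bar>snd \<theta>s t $ q $ l - snd \<theta> t $ \<sigma> q $ \<sigma> l\<bar> \<le> d"
  shows "\<theta> \<in> param_set T \<delta> \<zeta>"
    and "\<exists>\<sigma>. \<sigma> permutes UNIV \<and> (\<forall>t\<in>{1..T}. \<forall>q l. \<bar>snd \<theta>s t $ q $ l - snd \<theta> t $ \<sigma> q $ \<sigma> l\<bar> \<le> d)"
proof -
  have "\<forall>t\<in>{1..T}. \<exists>\<sigma>. \<forall>q l. \<bar>snd \<theta>s t $ q $ l - snd \<theta> t $ \<sigma> q $ \<sigma> l\<bar> \<le> d"
    using match by (rule ballI)
  from bchoice[OF this] obtain \<sigma>
    where *: "\<forall>t\<in>{1..T}. \<forall>q l. \<bar>snd \<theta>s t $ q $ l - snd \<theta> t $ \<sigma> t q $ \<sigma> t l\<bar> \<le> d" ..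
  then have \<sigma>: "\<bar>snd \<theta>s t $ q $ l - snd \<theta> t $ \<sigma> t q $ \<sigma> t l\<bar> \<le> d" if "t \<in> {1..T}" for t q l
    using that by blast
  have T1: "1 \<in> {1..T}" using T by simp
  have close: "\<bar>snd \<theta>s 1 $ q $ q - snd \<theta> 1 $ \<sigma> t q $ \<sigma> t q\<bar> \<le> d" if t: "t \<in> {1..T}" for t q
    using \<sigma>[OF t, of q q] unfolding param_closure_diagonal[OF \<theta>s t T1] param_closure_diagonal[OF \<theta> t T1] .
  have eqI: "q = q'" if "t \<in> {1..T}" "t' \<in> {1..T}" "snd \<theta> 1 $ \<sigma> t q $ \<sigma> t q = snd \<theta> 1 $ \<sigma> t' q' $ \<sigma> t' q'" for t t' q q'
  proof (rule ccontr)
    assume "q \<noteq> q'"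
    from gap[OF this] close[OF that(1), of q] close[OF that(2), of q'] that(3) show False by linarith
  qed
  have "inj (\<sigma> 1)"
    by (rule injI) (auto intro: eqI[OF T1 T1])
  then have bij: "bij (\<sigma> 1)"
    by (simp add: bij_def finite_UNIV_inj_surj)
  have same: "\<sigma> t = \<sigma> 1" if t: "t \<in> {1..T}" for t
  proof
    fix q
    obtain q' where q': "\<sigma> t q = \<sigma> 1 q'" using bij by (metis bij_pointE)
    then have "q = q'" by (intro eqI[OF t T1]) simp
    with q' show "\<sigma> t q = \<sigma> 1 q" by simp
  qed
  have "inj (\<lambda>m. snd \<theta> 1 $ m $ m)"
  proof (rule injI)
    fix k k' assume eq: "snd \<theta> 1 $ k $ k = snd \<theta> 1 $ k' $ k'"
    obtain q q' where "k = \<sigma> 1 q" "k' = \<sigma> 1 q'" using bij by (metis bij_pointE)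
    with eqI[OF T1 T1, of q q'] eq show "k = k'" by simp
  qed
  note inj1 = this
  show "\<theta> \<in> param_set T \<delta> \<zeta>"
  proof (rule param_closure_inj_diagonal[OF \<theta>])
    fix t assume t: "t \<in> {1..T}"
    have "(\<lambda>m. snd \<theta> t $ m $ m) = (\<lambda>m. snd \<theta> 1 $ m $ m)"
      by (rule ext) (rule param_closure_diagonal[OF \<theta> t T1])
    with inj1 show "inj (\<lambda>m. snd \<theta> t $ m $ m)" by (simp only:)
  qed
  have "\<sigma> 1 permutes UNIV" using bij by (intro bij_imp_permutes) auto
  moreover have "\<forall>t\<in>{1..T}. \<forall>q l. \<bar>snd \<theta>s t $ q $ l - snd \<theta> t $ \<sigma> 1 q $ \<sigma> 1 l\<bar> \<le> d"
  proof (intro ballI allI)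
    fix t q l assume t: "t \<in> {1..T}"
    show "\<bar>snd \<theta>s t $ q $ l - snd \<theta> t $ \<sigma> 1 q $ \<sigma> 1 l\<bar> \<le> d"
      using \<sigma>[OF t, of q l] unfolding same[OF t] .
  qed
  ultimately show "\<exists>\<sigma>. \<sigma> permutes UNIV \<and> (\<forall>t\<in>{1..T}. \<forall>q l. \<bar>snd \<theta>s t $ q $ l - snd \<theta> t $ \<sigma> q $ \<sigma> l\<bar> \<le> d)"
    by blast
qed

section \<open>Consistency of the maximum likelihood estimator\<close>

lemma Min_conn_dist_le:
  fixes \<pi> \<pi>' :: "nat \<Rightarrow> real^('q::finite)^'q"
  assumes T: "1 \<le> T" and "\<sigma> permutes UNIV"
    and d: "\<forall>t\<in>{1..T}. \<forall>q l. \<bar>\<pi> t $ q $ l - \<pi>' t $ \<sigma> q $ \<sigma> l\<bar> \<le> d"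
  shows "(MIN \<sigma>\<in>{\<sigma>. \<sigma> permutes UNIV}. conn_dist T \<pi> (permute_conn \<sigma> \<pi>')) \<le> d"
proof -
  have "(MIN \<sigma>\<in>{\<sigma>. \<sigma> permutes UNIV}. conn_dist T \<pi> (permute_conn \<sigma> \<pi>')) \<le> conn_dist T \<pi> (permute_conn \<sigma> \<pi>')"
    using assms(2) by (intro Min_le) auto
  also have "\<dots> \<le> d"
    unfolding conn_dist_def permute_conn_def using T d by (intro Max.boundedI) auto
  finally show ?thesis .
qed

lemma diagonal_gap:
  fixes f :: "'q::finite \<Rightarrow> real"
  assumes "inj f"
  shows "\<exists>g>0. \<forall>q q'. q \<noteq> q' \<longrightarrow> g \<le> \<bar>f q - f q'\<bar>"
proof -
  \<comment> \<open>The element 1 only serves to make the set nonempty when there is a single label.\<close>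
  define G where "G = insert 1 ((\<lambda>(q, q'). \<bar>f q - f q'\<bar>) ` {(q, q'). q \<noteq> q'})"
  have fin: "finite G" by (simp add: G_def)
  have "0 < Min G"
    using fin assms by (subst Min_gr_iff) (auto simp: G_def dest: injD)
  moreover have "Min G \<le> \<bar>f q - f q'\<bar>" if "q \<noteq> q'" for q q'
    using that by (intro Min_le[OF fin]) (auto simp: G_def)
  ultimately show ?thesis by blast
qed

text \<open>
The maximizer on the compact enlargement is itself at least as likely as \<open>\<theta>s\<close>, so it has distinct diagonal
entries and is a maximizer on the parameter set. This is what makes the estimator a maximizer.
\<close>

lemma mle_close_if_competitive_params_close:
  fixes \<theta>s :: "'q::finite param" and est :: "graphs \<Rightarrow> 'q param"
  assumes T: "1 \<le> T" and \<theta>s: "\<theta>s \<in> param_set T \<delta> \<zeta>" and \<zeta>: "0 < \<zeta>" and \<delta>: "0 < \<delta>"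
    and mle: "is_mle n T \<delta> \<zeta> est" and y: "y \<in> edge_configs n T"
    and gap: "\<And>q q'. q \<noteq> q' \<Longrightarrow> 2 * d < \<bar>snd \<theta>s 1 $ q $ q - snd \<theta>s 1 $ q' $ q'\<bar>"
    and match: "\<And>(\<theta> :: 'q param) t. \<theta> \<in> param_closure T \<delta> \<zeta> \<Longrightarrow>
       likelihood n T \<theta>s (symmetrize y) \<le> likelihood n T \<theta> (symmetrize y) \<Longrightarrow> t \<in> {1..T} \<Longrightarrow>
       \<exists>\<sigma>. \<forall>q l. \<bar>snd \<theta>s t $ q $ l - snd \<theta> t $ \<sigma> q $ \<sigma> l\<bar> \<le> d"
  shows "(MIN \<sigma>\<in>{\<sigma>. \<sigma> permutes UNIV}. conn_dist T (snd \<theta>s) (permute_conn \<sigma> (snd (est (symmetrize y))))) \<le> d"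
proof -
  let ?x = "symmetrize y"
  let ?max = "is_arg_max (\<lambda>\<theta> :: 'q param. log_likelihood n T \<theta> ?x) (\<lambda>\<theta>. \<theta> \<in> param_set T \<delta> \<zeta>)"
  have \<theta>s': "\<theta>s \<in> param_closure T \<delta> \<zeta>" using \<theta>s param_set_subset_closure by blast
  have mono: "log_likelihood n T \<theta> ?x \<le> log_likelihood n T \<theta>' ?x \<longleftrightarrow> likelihood n T \<theta> ?x \<le> likelihood n T \<theta>' ?x"
    if "\<theta> \<in> param_closure T \<delta> \<zeta>" "\<theta>' \<in> param_closure T \<delta> \<zeta>" for \<theta> \<theta>' :: "'q param"
    using likelihood_pos[OF that(1) \<zeta> y] likelihood_pos[OF that(2) \<zeta> y] by (simp add: log_likelihood_eq)
  obtain \<theta>m :: "'q param" where \<theta>m: "\<theta>m \<in> param_closure T \<delta> \<zeta>"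
    and best: "\<And>\<theta> :: 'q param. \<theta> \<in> param_closure T \<delta> \<zeta> \<Longrightarrow> likelihood n T \<theta> ?x \<le> likelihood n T \<theta>m ?x"
    using likelihood_maximizer_exists[OF T \<theta>s' \<zeta> \<delta> y] by blast
  have "\<theta>m \<in> param_set T \<delta> \<zeta>"
    by (rule relabelings_agree(1)[OF T \<theta>s' \<theta>m gap match[OF \<theta>m best[OF \<theta>s']]])
  then have "?max \<theta>m"
    using best mono[OF _ \<theta>m] param_set_subset_closure
    unfolding is_arg_max_def by (meson linorder_not_less subsetD)
  then have max: "?max (est ?x)"
    using mle unfolding is_mle_def by blast
  then have est: "est ?x \<in> param_closure T \<delta> \<zeta>"
    using param_set_subset_closure by (auto simp: is_arg_max_def)
  have "log_likelihood n T \<theta>s ?x \<le> log_likelihood n T (est ?x) ?x"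
    using max \<theta>s unfolding is_arg_max_def by (meson not_less)
  then have "likelihood n T \<theta>s ?x \<le> likelihood n T (est ?x) ?x"
    by (simp add: mono[OF \<theta>s' est])
  then obtain \<sigma> where "\<sigma> permutes UNIV"
    "\<forall>t\<in>{1..T}. \<forall>q l. \<bar>snd \<theta>s t $ q $ l - snd (est ?x) t $ \<sigma> q $ \<sigma> l\<bar> \<le> d"
    using relabelings_agree(2)[OF T \<theta>s' est gap match[OF est]] by blast
  then show ?thesis by (rule Min_conn_dist_le[OF T])
qed

theorem corollary2:
  fixes T :: nat and \<delta> \<zeta> \<epsilon> :: real
    and \<theta>s :: "('q :: finite) param"
    and est :: "nat \<Rightarrow> graphs \<Rightarrow> 'q param"
    and r :: "nat \<Rightarrow> real"
  assumes "T \<ge> 1" and "CARD('q) \<ge> 2"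
    and "0 < \<delta>" and "\<delta> < 1 / real CARD('q)"
    and "0 < \<zeta>" and "\<zeta> < 1 / 2"
    and "\<theta>s \<in> param_set T \<delta> \<zeta>"
    and "\<And>n. n \<ge> 1 \<Longrightarrow> is_mle n T \<delta> \<zeta> (est n)"
    and "\<epsilon> > 0"
    and "\<And>n. n \<ge> 1 \<Longrightarrow> r n > 0"
    and "filterlim r at_top sequentially"
    and "r \<in> o(\<lambda>n. real n powr (1 / 4))"
  shows "(\<lambda>n. measure_pmf.prob (model_law n T \<theta>s)
            {(z, x). (MIN \<sigma>\<in>{\<sigma>. \<sigma> permutes UNIV}.
                        conn_dist T (snd \<theta>s) (permute_conn \<sigma> (snd (est n x))))
                      > \<epsilon> * r n / real n powr (1 / 4)})
         \<longlonglongrightarrow> 0"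
proof -
  let ?Q = "CARD('q)"
  define C where "C = 2 * (excess_rate T \<zeta> ?Q + T * ln (1 / \<delta>))"
  \<comment> \<open>The bound of \<open>matching_at_each_time\<close> for classes of size \<open>\<delta> * n / 4\<close> is \<open>s / sqrt n\<close>.\<close>
  define s where "s = sqrt (4 * C * ?Q\<^sup>2 / (\<delta> / 4)\<^sup>2)"
  define E where "E = (\<lambda>n. {(z :: 'q labels, x). (MIN \<sigma>\<in>{\<sigma>. \<sigma> permutes UNIV}.
                        conn_dist T (snd \<theta>s) (permute_conn \<sigma> (snd (est n x))))
                      > \<epsilon> * r n / real n powr (1 / 4)})"
  have \<theta>s: "\<theta>s \<in> param_closure T \<delta> \<zeta>"
    using \<open>\<theta>s \<in> param_set T \<delta> \<zeta>\<close> param_set_subset_closure by blast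
  have st: "stochastic (fst \<theta>s)" and ge: "\<And>q l. \<delta> \<le> fst \<theta>s $ q $ l"
    using \<theta>s by (auto simp: param_closure_def)
  have "inj (\<lambda>q. snd \<theta>s 1 $ q $ q)"
    using \<open>\<theta>s \<in> param_set T \<delta> \<zeta>\<close> \<open>T \<ge> 1\<close> by (intro param_set_inj_diagonal) auto
  from diagonal_gap[OF this] obtain g
    where g: "0 < g" "\<forall>q q'. q \<noteq> q' \<longrightarrow> g \<le> \<bar>snd \<theta>s 1 $ q $ q - snd \<theta>s 1 $ q' $ q'\<bar>"
    by (elim exE conjE)
  have bound: "measure_pmf.prob (model_law n T \<theta>s) (E n) \<le> T * ?Q * exp (- (\<delta> * n / 4)) + exp (- real n)"
    if n: "1 \<le> n" "2 * ?Q \<le> \<delta> / 4 * n" and small: "2 * (s / sqrt n) < g"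
      and thr: "s / sqrt n \<le> \<epsilon> * r n / real n powr (1 / 4)" for n
  proof -
    have "measure_pmf.prob (model_law n T \<theta>s) (E n)
        \<le> measure_pmf.prob (label_law n T (fst \<theta>s)) (unbalanced n T (\<delta> / 4)) + exp (- real n)"
      unfolding model_law_def
    proof (rule prob_bind_pmf_le)
      fix z assume z: "z \<in> set_pmf (label_law n T (fst \<theta>s))" and bal: "z \<notin> unbalanced n T (\<delta> / 4)"
      let ?Good = "\<lambda>x. \<exists>y\<in>edge_configs n T. x = symmetrize y \<and>
          (\<forall>\<theta>\<in>param_closure T \<delta> \<zeta>. likelihood n T \<theta>s x \<le> likelihood n T \<theta> x \<longrightarrow>
            (\<exists>z'. sq_discrepancy n T (snd \<theta>s) z (snd \<theta>) z' \<le> C * n))"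
      have good: "(z, x) \<notin> E n" if x_good: "?Good x" for x
      proof -
        obtain y where y: "y \<in> edge_configs n T" and x: "x = symmetrize y"
          and disc: "\<And>\<theta>. \<theta> \<in> param_closure T \<delta> \<zeta> \<Longrightarrow> likelihood n T \<theta>s x \<le> likelihood n T \<theta> x \<Longrightarrow>
            \<exists>z'. sq_discrepancy n T (snd \<theta>s) z (snd \<theta>) z' \<le> C * n"
          using x_good by blast
        have "(MIN \<sigma>\<in>{\<sigma>. \<sigma> permutes UNIV}. conn_dist T (snd \<theta>s) (permute_conn \<sigma> (snd (est n (symmetrize y)))))
          \<le> s / sqrt n"
        proof (rule mle_close_if_competitive_params_close[OF \<open>T \<ge> 1\<close> \<open>\<theta>s \<in> param_set T \<delta> \<zeta>\<close> \<open>0 < \<zeta>\<close> \<open>0 < \<delta>\<close> _ y])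
          show "is_mle n T \<delta> \<zeta> (est n)" using n assms(8) by blast
          show "2 * (s / sqrt n) < \<bar>snd \<theta>s 1 $ q $ q - snd \<theta>s 1 $ q' $ q'\<bar>" if "q \<noteq> q'" for q q'
            using g(2)[rule_format, OF that] small by linarith
          fix \<theta> :: "'q param" and t assume \<theta>: "\<theta> \<in> param_closure T \<delta> \<zeta>" and t: "t \<in> {1..T}"
            and "likelihood n T \<theta>s (symmetrize y) \<le> likelihood n T \<theta> (symmetrize y)"
          then obtain z' where "sq_discrepancy n T (snd \<theta>s) z (snd \<theta>) z' \<le> C * n"
            using disc x by blast
          from matching_at_each_time[OF \<theta>s \<theta> t bal n(2) this]
          show "\<exists>\<sigma>. \<forall>q l. \<bar>snd \<theta>s t $ q $ l - snd \<theta> t $ \<sigma> q $ \<sigma> l\<bar> \<le> s / sqrt n"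
            by (simp only: s_def real_sqrt_divide)
        qed
        with thr show ?thesis unfolding E_def x by simp
      qed
      have "measure_pmf.prob (graph_law n T (snd \<theta>s) z \<bind> (\<lambda>x. return_pmf (z, x))) (E n)
          = measure_pmf.prob (graph_law n T (snd \<theta>s) z) (Pair z -` E n)"
        by (simp flip: map_pmf_def)
      also have "\<dots> \<le> measure_pmf.prob (graph_law n T (snd \<theta>s) z) {x. \<not> ?Good x}"
      proof (rule measure_pmf.finite_measure_mono)
        show "Pair z -` E n \<subseteq> {x. \<not> ?Good x}"
        proof (rule subsetI, unfold mem_Collect_eq, rule notI)
          fix x assume "x \<in> Pair z -` E n" "?Good x"
          from good[OF this(2)] vimageD[OF this(1)] show False by (rule notE)
        qed
      qed simp
      also have "\<dots> \<le> exp (- real n)"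
        unfolding C_def using z set_label_law assms(3,5,6) n(1)
        by (intro competitive_params_have_small_discrepancy[OF \<theta>s]) auto
      finally show "measure_pmf.prob (graph_law n T (snd \<theta>s) z \<bind> (\<lambda>x. return_pmf (z, x))) (E n) \<le> exp (- real n)" .
    qed simp
    with prob_unbalanced[OF st \<open>0 < \<delta>\<close> ge, of n T] show ?thesis by linarith
  qed
  have lim: "(\<lambda>n. T * ?Q * exp (- (\<delta> * real n / 4)) + exp (- real n)) \<longlonglongrightarrow> 0"
  proof (intro tendsto_add_zero tendsto_mult_right_zero)
    show "(\<lambda>n. exp (- (\<delta> * real n / 4))) \<longlonglongrightarrow> 0" using \<open>0 < \<delta>\<close> by real_asymp
    show "(\<lambda>n. exp (- real n)) \<longlonglongrightarrow> 0" by real_asymp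
  qed
  have "(\<lambda>n. 1 / sqrt (real n)) \<longlonglongrightarrow> 0" by real_asymp
  from tendsto_mult_right_zero[OF this, of "2 * s"] have "(\<lambda>n. 2 * (s / sqrt (real n))) \<longlonglongrightarrow> 0" by simp
  from order_tendstoD(2)[OF this \<open>0 < g\<close>]
  have ev1: "\<forall>\<^sub>F n in sequentially. 2 * (s / sqrt n) < g" .
  have "(\<lambda>n. real n powr (1 / 4) / sqrt (real n)) \<longlonglongrightarrow> 0" by real_asymp
  from tendsto_mult_right_zero[OF this, of s]
  have "(\<lambda>n. s * (real n powr (1 / 4) / sqrt (real n))) \<longlonglongrightarrow> 0" .
  from order_tendstoD(2)[OF this \<open>\<epsilon> > 0\<close>]
  have ev2: "\<forall>\<^sub>F n in sequentially. s * (real n powr (1 / 4) / sqrt n) < \<epsilon>" .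
  have ev3: "\<forall>\<^sub>F n in sequentially. 1 \<le> r n"
    using \<open>filterlim r at_top sequentially\<close> by (simp add: filterlim_at_top)
  have "filterlim (\<lambda>n. \<delta> / 4 * real n) at_top sequentially"
    using \<open>0 < \<delta>\<close> by real_asymp
  then have ev4: "\<forall>\<^sub>F n in sequentially. real (2 * ?Q) \<le> \<delta> / 4 * real n"
    unfolding filterlim_at_top ..
  have "\<forall>\<^sub>F n in sequentially. measure_pmf.prob (model_law n T \<theta>s) (E n)
      \<le> T * ?Q * exp (- (\<delta> * real n / 4)) + exp (- real n)"
    using ev1 ev2 ev3 ev4 eventually_ge_at_top[of 1]
  proof eventually_elim
    case (elim n)
    show ?case
    proof (rule bound)
      have "s / sqrt n * real n powr (1 / 4) \<le> \<epsilon> * r n"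
      proof -
        have "\<epsilon> * 1 \<le> \<epsilon> * r n" using elim \<open>\<epsilon> > 0\<close> by (intro mult_left_mono) auto
        with elim show ?thesis by simp
      qed
      then show "s / sqrt n \<le> \<epsilon> * r n / real n powr (1 / 4)"
        using elim by (simp add: pos_le_divide_eq)
    qed (use elim in auto)
  qed
  then have "(\<lambda>n. measure_pmf.prob (model_law n T \<theta>s) (E n)) \<longlonglongrightarrow> 0"
    by (intro tendsto_sandwich[OF _ _ tendsto_const lim]) auto
  then show ?thesis unfolding E_def .
qed

end
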